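(* Let $(\mathfrak{g},[~,~]_1,[~,~]_2,\alpha)$ be a compatible Hom-Lie algebra and $p\in\mathbb{N}$. An order $p$ deformation $(\mu_{1,t},\mu_{2,t})$ of $(\mathfrak{g},[~,~]_1,[~,~]_2,\alpha)$ is extensible if and only if the corresponding obstruction class $[Ob_{(\mu_{1,t},\mu_{2,t})}]\in H^3_{\mathrm{cHom}}(\mathfrak{g},\mathfrak{g})$ is trivial.
   Context: All vector spaces are over a field $\mathbb{K}$ of characteristic zero. A Hom-Lie algebra $(\mathfrak{g},[~,~],\alpha)$ is a vector space $\mathfrak{g}$ with a bilinear skew-symmetric bracket and a linear map $\alpha:\mathfrak{g}\to\mathfrak{g}$ such that $\alpha[x,y]=[\alpha(x),\alpha(y)]$ and $[[x,y],\alpha(z)]+[[y,z],\alpha(x)]+[[z,x],\alpha(y)]=0$ for all $x,y,z\in\mathfrak{g}$. A compatible Hom-Lie algebra $(\mathfrak{g},[~,~]_1,[~,~]_2,\alpha)$ consists of two Hom-Lie algebras $(\mathfrak{g},[~,~]_1,\alpha)$, $(\mathfrak{g},[~,~]_2,\alpha)$ such that $(\mathfrak{g},\lambda[~,~]_1+\eta[~,~]_2,\alpha)$ is a Hom-Lie algebra for all $\lambda,\eta\in\mathbb{K}$. The same definitions apply over a commutative $\mathbb{K}$-algebra in place of $\mathbb{K}$. For $n\ge1$, $C^n_{\mathrm{Hom}}(\mathfrak{g},\mathfrak{g})=\{f:\wedge^n\mathfrak{g}\to\mathfrak{g}\text{ linear}\mid\alpha\circ f=f\circ\alpha^{\wedge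 n}\}$. For $P\in C^{m+1}_{\mathrm{Hom}}(\mathfrak{g},\mathfrak{g})$, $Q\in C^{n+1}_{\mathrm{Hom}}(\mathfrak{g},\mathfrak{g})$, $m,n\ge0$, the Nijenhuis-Richardson bracket is $[P,Q]_{\mathsf{NR}}=P\diamond Q-(-1)^{mn}Q\diamond P\in C^{m+n+1}_{\mathrm{Hom}}(\mathfrak{g},\mathfrak{g})$, with $$(P\diamond Q)(x_1,\ldots,x_{m+n+1})=\sum_{\sigma\in Sh(n+1,m)}(-1)^\sigma P\big(Q(x_{\sigma(1)},\ldots,x_{\sigma(n+1)}),\alpha^n(x_{\sigma(n+2)}),\ldots,\alpha^n(x_{\sigma(m+n+1)})\big),$$ the sum being over $(n+1,m)$-shuffles. Let $\mu_1,\mu_2\in C^2_{\mathrm{Hom}}(\mathfrak{g},\mathfrak{g})$ correspond to $[~,~]_1,[~,~]_2$. Cohomology with adjoint coefficients: for $i=1,2$ and $f\in C^n_{\mathrm{Hom}}(\mathfrak{g},\mathfrak{g})$, $n\ge1$, $$({}^i\delta_{\mathrm{Hom}}f)(x_1,\ldots,x_{n+1})=\sum_{k=1}^{n+1}(-1)^{k+1}[\alpha^{n-1}(x_k),f(x_1,\ldots,\widehat{x_k},\ldots,x_{n+1})]_i+\sum_{1\le k<l\le n+1}(-1)^{k+l}f([x_k,x_l]_i,\alpha(x_1),\ldots,\widehat{\alpha(x_k)},\ldots,\widehat{\alpha(x_l)},\ldots,\alpha(x_{n+1})),$$ equivalently ${}^i\delta_{\mathrm{Hom}}f=(-1)^{n-1}[\mu_i,f]_{\mathsf{NR}}$.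 For $n\ge1$, $C^n_{\mathrm{cHom}}(\mathfrak{g},\mathfrak{g})=C^n_{\mathrm{Hom}}(\mathfrak{g},\mathfrak{g})^{\oplus n}$ and $\delta_{\mathrm{cHom}}(f_1,\ldots,f_n)=({}^1\delta_{\mathrm{Hom}}f_1,\ldots,{}^1\delta_{\mathrm{Hom}}f_i+{}^2\delta_{\mathrm{Hom}}f_{i-1},\ldots,{}^2\delta_{\mathrm{Hom}}f_n)$ (the middle entries in positions $2\le i\le n$). $H^3_{\mathrm{cHom}}(\mathfrak{g},\mathfrak{g})=\ker(\delta_{\mathrm{cHom}}:C^3_{\mathrm{cHom}}\to C^4_{\mathrm{cHom}})/\mathrm{Im}(\delta_{\mathrm{cHom}}:C^2_{\mathrm{cHom}}\to C^3_{\mathrm{cHom}})$. An order $p$ deformation of $(\mathfrak{g},[~,~]_1,[~,~]_2,\alpha)$ is a pair $(\mu_{1,t},\mu_{2,t})$ with $\mu_{1,t}=\sum_{i=0}^pt^i\mu_{1,i}$, $\mu_{2,t}=\sum_{i=0}^pt^i\mu_{2,i}$, where $\mu_{1,i},\mu_{2,i}\in C^2_{\mathrm{Hom}}(\mathfrak{g},\mathfrak{g})$ and $\mu_{1,0}=\mu_1$, $\mu_{2,0}=\mu_2$, such that $(\mathfrak{g}[[t]]/(t^{p+1}),\mu_{1,t},\mu_{2,t},\alpha)$ (with $\mu_{1,t},\mu_{2,t},\alpha$ extended $\mathbb{K}[[t]]/(t^{p+1})$-(bi)linearly) is a compatible Hom-Lie algebra over $\mathbb{K}[[t]]/(t^{p+1})$.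 It is extensible if there exists $(\mu_{1,p+1},\mu_{2,p+1})\in C^2_{\mathrm{cHom}}(\mathfrak{g},\mathfrak{g})$ such that $(\mu_{1,t}+t^{p+1}\mu_{1,p+1},\ \mu_{2,t}+t^{p+1}\mu_{2,p+1})$ is a deformation of order $p+1$. The obstruction cochain $$Ob_{(\mu_{1,t},\mu_{2,t})}=\Big(\tfrac12\sum_{\substack{i+j=p+1\\ i,j\ge1}}[\mu_{1,i},\mu_{1,j}]_{\mathsf{NR}},\ \sum_{\substack{i+j=p+1\\ i,j\ge1}}[\mu_{1,i},\mu_{2,j}]_{\mathsf{NR}},\ \tfrac12\sum_{\substack{i+j=p+1\\ i,j\ge1}}[\mu_{2,i},\mu_{2,j}]_{\mathsf{NR}}\Big)\in C^3_{\mathrm{cHom}}(\mathfrak{g},\mathfrak{g})$$ satisfies $\delta_{\mathrm{cHom}}(Ob_{(\mu_{1,t},\mu_{2,t})})=0$, and its class in $H^3_{\mathrm{cHom}}(\mathfrak{g},\mathfrak{g})$ is the obstruction class. *)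

theory Defs
  imports "HOL-Algebra.Module" "HOL-Algebra.Product_Groups" "HOL-Combinatorics.Permutations"
begin

section \<open>Compatible Hom-Lie algebras over a commutative ring\<close>

definition module_endo ::
  "('r, 'a) ring_scheme \<Rightarrow> ('r, 'v, 'b) module_scheme \<Rightarrow> ('v \<Rightarrow> 'v) \<Rightarrow> bool" where
  "module_endo R M f \<longleftrightarrow>
     f \<in> carrier M \<rightarrow> carrier M \<and>
     (\<forall>x\<in>carrier M. \<forall>y\<in>carrier M. f (x \<oplus>\<^bsub>M\<^esub> y) = f x \<oplus>\<^bsub>M\<^esub> f y) \<and>
     (\<forall>a\<in>carrier R. \<forall>x\<in>carrier M. f (a \<odot>\<^bsub>M\<^esub> x) = a \<odot>\<^bsub>M\<^esub> f x)"

definition bilinear_op ::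
  "('r, 'a) ring_scheme \<Rightarrow> ('r, 'v, 'b) module_scheme \<Rightarrow> ('v \<Rightarrow> 'v \<Rightarrow> 'v) \<Rightarrow> bool" where
  "bilinear_op R M br \<longleftrightarrow>
     (\<forall>x\<in>carrier M. module_endo R M (br x)) \<and>
     (\<forall>y\<in>carrier M. module_endo R M (\<lambda>x. br x y))"

locale hom_lie_algebra = module R M
  for R :: "('r, 'a) ring_scheme" (structure) and M :: "('r, 'v, 'b) module_scheme" (structure) +
  fixes br :: "'v \<Rightarrow> 'v \<Rightarrow> 'v" and \<alpha> :: "'v \<Rightarrow> 'v"
  assumes twist_linear: "module_endo R M \<alpha>"
    and bilinear: "bilinear_op R M br"
    and skew: "\<lbrakk>x \<in> carrier M; y \<in> carrier M\<rbrakk> \<Longrightarrow> br x y = \<ominus>\<^bsub>M\<^esub> br y x"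
    and multiplicative: "\<lbrakk>x \<in> carrier M; y \<in> carrier M\<rbrakk> \<Longrightarrow> \<alpha> (br x y) = br (\<alpha> x) (\<alpha> y)"
    and hom_jacobi: "\<lbrakk>x \<in> carrier M; y \<in> carrier M; z \<in> carrier M\<rbrakk> \<Longrightarrow>
      br (br x y) (\<alpha> z) \<oplus>\<^bsub>M\<^esub> br (br y z) (\<alpha> x) \<oplus>\<^bsub>M\<^esub> br (br z x) (\<alpha> y) = \<zero>\<^bsub>M\<^esub>"

locale compatible_hom_lie_algebra =
  first: hom_lie_algebra R M br\<^sub>1 \<alpha> + second: hom_lie_algebra R M br\<^sub>2 \<alpha>
  for R :: "('r, 'a) ring_scheme" (structure)
    and M :: "('r, 'v, 'b) module_scheme" (structure)
    and br\<^sub>1 br\<^sub>2 :: "'v \<Rightarrow> 'v \<Rightarrow> 'v" and \<alpha> :: "'v \<Rightarrow> 'v" +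
  assumes compatible: "\<lbrakk>l \<in> carrier R; e \<in> carrier R\<rbrakk> \<Longrightarrow>
    hom_lie_algebra R M (\<lambda>x y. l \<odot>\<^bsub>M\<^esub> br\<^sub>1 x y \<oplus>\<^bsub>M\<^esub> e \<odot>\<^bsub>M\<^esub> br\<^sub>2 x y) \<alpha>"

definition char_zero :: "('k, 'a) ring_scheme \<Rightarrow> bool" where
  "char_zero K \<longleftrightarrow> (\<forall>n::nat. n > 0 \<longrightarrow> [n] \<cdot>\<^bsub>K\<^esub> \<one>\<^bsub>K\<^esub> \<noteq> \<zero>\<^bsub>K\<^esub>)"


section \<open>Cochains and the Nijenhuis-Richardson bracket\<close>

text \<open>An \<open>n\<close>-cochain, i.e. a linear map on the \<open>n\<close>-th exterior power that commutes with the
  twist, is represented by the corresponding alternating multilinear map. Its arguments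
  \<open>x\<^sub>1, \<dots>, x\<^sub>n\<close> form a list, so positions are counted from \<open>0\<close>. It is extensional (constantly
  \<open>undefined\<close> off its domain), so that equality of cochains is equality of functions.\<close>

definition args :: "('k, 'v, 'b) module_scheme \<Rightarrow> nat \<Rightarrow> 'v list set" where
  "args G n = {xs. length xs = n \<and> set xs \<subseteq> carrier G}"

definition hom_cochains ::
  "('k, 'a) ring_scheme \<Rightarrow> ('k, 'v, 'b) module_scheme \<Rightarrow> ('v \<Rightarrow> 'v) \<Rightarrow> nat \<Rightarrow>
   ('v list \<Rightarrow> 'v) set" where
  "hom_cochains K G \<alpha> n = {f \<in> args G n \<rightarrow>\<^sub>E carrier G.
     (\<forall>xs\<in>args G n. \<forall>i<n. module_endo K G (\<lambda>y. f (xs[i := y]))) \<and>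
     (\<forall>xs\<in>args G n. \<forall>i<n. \<forall>j<n. i \<noteq> j \<and> xs ! i = xs ! j \<longrightarrow> f xs = \<zero>\<^bsub>G\<^esub>) \<and>
     (\<forall>xs\<in>args G n. \<alpha> (f xs) = f (map \<alpha> xs))}"

definition bracket_cochain ::
  "('k, 'v, 'b) module_scheme \<Rightarrow> ('v \<Rightarrow> 'v \<Rightarrow> 'v) \<Rightarrow> 'v list \<Rightarrow> 'v" where
  "bracket_cochain G br = (\<lambda>xs\<in>args G 2. br (xs ! 0) (xs ! 1))"

definition shuffle_perms :: "nat \<Rightarrow> nat \<Rightarrow> (nat \<Rightarrow> nat) set" where
  "shuffle_perms p q = {\<sigma>. \<sigma> permutes {..<p + q} \<and>
     strict_mono_on {..<p} \<sigma> \<and> strict_mono_on {p..<p + q} \<sigma>}"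

text \<open>In the next two definitions \<open>P\<close> has \<open>m + 1\<close> and \<open>Q\<close> has \<open>n + 1\<close> arguments.\<close>

definition nr_comp ::
  "('k, 'v, 'b) module_scheme \<Rightarrow> ('v \<Rightarrow> 'v) \<Rightarrow> nat \<Rightarrow> nat \<Rightarrow>
   ('v list \<Rightarrow> 'v) \<Rightarrow> ('v list \<Rightarrow> 'v) \<Rightarrow> 'v list \<Rightarrow> 'v" where
  "nr_comp G \<alpha> m n P Q = (\<lambda>xs\<in>args G (m + n + 1).
     \<Oplus>\<^bsub>G\<^esub>\<sigma>\<in>shuffle_perms (n + 1) m. [sign \<sigma>] \<cdot>\<^bsub>G\<^esub>
       P (Q (map (\<lambda>i. xs ! \<sigma> i) [0..<n + 1]) #
          map (\<lambda>i. (\<alpha> ^^ n) (xs ! \<sigma> i)) [n + 1..<m + n + 1]))"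

definition nr_bracket ::
  "('k, 'v, 'b) module_scheme \<Rightarrow> ('v \<Rightarrow> 'v) \<Rightarrow> nat \<Rightarrow> nat \<Rightarrow>
   ('v list \<Rightarrow> 'v) \<Rightarrow> ('v list \<Rightarrow> 'v) \<Rightarrow> 'v list \<Rightarrow> 'v" where
  "nr_bracket G \<alpha> m n P Q = (\<lambda>xs\<in>args G (m + n + 1).
     nr_comp G \<alpha> m n P Q xs \<ominus>\<^bsub>G\<^esub> [((-1 :: int) ^ (m * n))] \<cdot>\<^bsub>G\<^esub> nr_comp G \<alpha> n m Q P xs)"


section \<open>Cohomology with adjoint coefficients\<close>

text \<open>The coboundary of an \<open>n\<close>-cochain, \<open>n \<ge> 1\<close>; \<open>nths xs (- A)\<close> omits the entries at the
  positions in \<open>A\<close>. Since positions start at \<open>0\<close>, the exponent \<open>k + 1\<close> of the first sum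
  becomes \<open>k\<close>, and the parity of \<open>k + l\<close> in the second sum is unaffected.\<close>

definition hom_delta ::
  "('k, 'v, 'b) module_scheme \<Rightarrow> ('v \<Rightarrow> 'v \<Rightarrow> 'v) \<Rightarrow> ('v \<Rightarrow> 'v) \<Rightarrow> nat \<Rightarrow>
   ('v list \<Rightarrow> 'v) \<Rightarrow> 'v list \<Rightarrow> 'v" where
  "hom_delta G br \<alpha> n f = (\<lambda>xs\<in>args G (n + 1).
     (\<Oplus>\<^bsub>G\<^esub>k\<in>{..n}. [((-1 :: int) ^ k)] \<cdot>\<^bsub>G\<^esub>
        br ((\<alpha> ^^ (n - 1)) (xs ! k)) (f (nths xs (- {k})))) \<oplus>\<^bsub>G\<^esub>
     (\<Oplus>\<^bsub>G\<^esub>l\<in>{..n}. \<Oplus>\<^bsub>G\<^esub>k\<in>{..<l}. [((-1 :: int) ^ (k + l))] \<cdot>\<^bsub>G\<^esub>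
        f (br (xs ! k) (xs ! l) # map \<alpha> (nths xs (- {k, l})))))"

text \<open>The additive groups of cochains are written multiplicatively, so that the product and
  quotient groups of the library apply.\<close>

definition hom_cochain_group ::
  "('k, 'a) ring_scheme \<Rightarrow> ('k, 'v, 'b) module_scheme \<Rightarrow> ('v \<Rightarrow> 'v) \<Rightarrow> nat \<Rightarrow>
   ('v list \<Rightarrow> 'v) monoid" where
  "hom_cochain_group K G \<alpha> n =
     \<lparr>carrier = hom_cochains K G \<alpha> n,
      monoid.mult = (\<lambda>f g. \<lambda>xs\<in>args G n. f xs \<oplus>\<^bsub>G\<^esub> g xs),
      one = (\<lambda>xs\<in>args G n. \<zero>\<^bsub>G\<^esub>)\<rparr>"

definition chom_cochain_group ::
  "('k, 'a) ring_scheme \<Rightarrow> ('k, 'v, 'b) module_scheme \<Rightarrow> ('v \<Rightarrow> 'v) \<Rightarrow> nat \<Rightarrow>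
   (nat \<Rightarrow> 'v list \<Rightarrow> 'v) monoid" where
  "chom_cochain_group K G \<alpha> n = product_group {1..n} (\<lambda>_. hom_cochain_group K G \<alpha> n)"

definition chom_delta ::
  "('k, 'a) ring_scheme \<Rightarrow> ('k, 'v, 'b) module_scheme \<Rightarrow> ('v \<Rightarrow> 'v \<Rightarrow> 'v) \<Rightarrow>
   ('v \<Rightarrow> 'v \<Rightarrow> 'v) \<Rightarrow> ('v \<Rightarrow> 'v) \<Rightarrow> nat \<Rightarrow>
   (nat \<Rightarrow> 'v list \<Rightarrow> 'v) \<Rightarrow> nat \<Rightarrow> 'v list \<Rightarrow> 'v" where
  "chom_delta K G br\<^sub>1 br\<^sub>2 \<alpha> n f = (\<lambda>i\<in>{1..n + 1}.
     if i = 1 then hom_delta G br\<^sub>1 \<alpha> n (f 1)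
     else if i = n + 1 then hom_delta G br\<^sub>2 \<alpha> n (f n)
     else hom_delta G br\<^sub>1 \<alpha> n (f i) \<otimes>\<^bsub>hom_cochain_group K G \<alpha> (n + 1)\<^esub>
          hom_delta G br\<^sub>2 \<alpha> n (f (i - 1)))"

definition chom_cocycles ::
  "('k, 'a) ring_scheme \<Rightarrow> ('k, 'v, 'b) module_scheme \<Rightarrow> ('v \<Rightarrow> 'v \<Rightarrow> 'v) \<Rightarrow>
   ('v \<Rightarrow> 'v \<Rightarrow> 'v) \<Rightarrow> ('v \<Rightarrow> 'v) \<Rightarrow> nat \<Rightarrow> (nat \<Rightarrow> 'v list \<Rightarrow> 'v) set" where
  "chom_cocycles K G br\<^sub>1 br\<^sub>2 \<alpha> n =
     kernel (chom_cochain_group K G \<alpha> n) (chom_cochain_group K G \<alpha> (n + 1))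
       (chom_delta K G br\<^sub>1 br\<^sub>2 \<alpha> n)"

text \<open>The following three definitions are meant for \<open>n \<ge> 2\<close>: cochains of degree \<open>0\<close> are not
  considered.\<close>

definition chom_coboundaries ::
  "('k, 'a) ring_scheme \<Rightarrow> ('k, 'v, 'b) module_scheme \<Rightarrow> ('v \<Rightarrow> 'v \<Rightarrow> 'v) \<Rightarrow>
   ('v \<Rightarrow> 'v \<Rightarrow> 'v) \<Rightarrow> ('v \<Rightarrow> 'v) \<Rightarrow> nat \<Rightarrow> (nat \<Rightarrow> 'v list \<Rightarrow> 'v) set" where
  "chom_coboundaries K G br\<^sub>1 br\<^sub>2 \<alpha> n =
     chom_delta K G br\<^sub>1 br\<^sub>2 \<alpha> (n - 1) ` carrier (chom_cochain_group K G \<alpha> (n - 1))"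

definition chom_cohomology ::
  "('k, 'a) ring_scheme \<Rightarrow> ('k, 'v, 'b) module_scheme \<Rightarrow> ('v \<Rightarrow> 'v \<Rightarrow> 'v) \<Rightarrow>
   ('v \<Rightarrow> 'v \<Rightarrow> 'v) \<Rightarrow> ('v \<Rightarrow> 'v) \<Rightarrow> nat \<Rightarrow> (nat \<Rightarrow> 'v list \<Rightarrow> 'v) set monoid" where
  "chom_cohomology K G br\<^sub>1 br\<^sub>2 \<alpha> n =
     (chom_cochain_group K G \<alpha> n)\<lparr>carrier := chom_cocycles K G br\<^sub>1 br\<^sub>2 \<alpha> n\<rparr>
       Mod chom_coboundaries K G br\<^sub>1 br\<^sub>2 \<alpha> n"

definition chom_class ::
  "('k, 'a) ring_scheme \<Rightarrow> ('k, 'v, 'b) module_scheme \<Rightarrow> ('v \<Rightarrow> 'v \<Rightarrow> 'v) \<Rightarrow>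
   ('v \<Rightarrow> 'v \<Rightarrow> 'v) \<Rightarrow> ('v \<Rightarrow> 'v) \<Rightarrow> nat \<Rightarrow>
   (nat \<Rightarrow> 'v list \<Rightarrow> 'v) \<Rightarrow> (nat \<Rightarrow> 'v list \<Rightarrow> 'v) set" where
  "chom_class K G br\<^sub>1 br\<^sub>2 \<alpha> n f =
     chom_coboundaries K G br\<^sub>1 br\<^sub>2 \<alpha> n
       #>\<^bsub>(chom_cochain_group K G \<alpha> n)\<lparr>carrier := chom_cocycles K G br\<^sub>1 br\<^sub>2 \<alpha> n\<rparr>\<^esub> f"


section \<open>Deformations of finite order\<close>

text \<open>The elements of \<open>K[[t]]/(t\<^sup>p\<^sup>+\<^sup>1)\<close> and of \<open>G[[t]]/(t\<^sup>p\<^sup>+\<^sup>1)\<close> are represented by their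
  coefficient families, indexed by \<open>{..p}\<close>.\<close>

definition trunc_ring :: "('k, 'a) ring_scheme \<Rightarrow> nat \<Rightarrow> (nat \<Rightarrow> 'k) ring" where
  "trunc_ring K p =
     \<lparr>carrier = {..p} \<rightarrow>\<^sub>E carrier K,
      monoid.mult = (\<lambda>a b. \<lambda>n\<in>{..p}. \<Oplus>\<^bsub>K\<^esub>i\<in>{..n}. a i \<otimes>\<^bsub>K\<^esub> b (n - i)),
      one = (\<lambda>n\<in>{..p}. if n = 0 then \<one>\<^bsub>K\<^esub> else \<zero>\<^bsub>K\<^esub>),
      zero = (\<lambda>n\<in>{..p}. \<zero>\<^bsub>K\<^esub>),
      add = (\<lambda>a b. \<lambda>n\<in>{..p}. a n \<oplus>\<^bsub>K\<^esub> b n)\<rparr>"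

text \<open>The fields \<open>mult\<close> and \<open>one\<close> of a module record play no role.\<close>

definition trunc_module ::
  "('k, 'v, 'b) module_scheme \<Rightarrow> nat \<Rightarrow> (nat \<Rightarrow> 'k, nat \<Rightarrow> 'v) module" where
  "trunc_module G p =
     \<lparr>carrier = {..p} \<rightarrow>\<^sub>E carrier G,
      monoid.mult = undefined,
      one = undefined,
      zero = (\<lambda>n\<in>{..p}. \<zero>\<^bsub>G\<^esub>),
      add = (\<lambda>x y. \<lambda>n\<in>{..p}. x n \<oplus>\<^bsub>G\<^esub> y n),
      smult = (\<lambda>a x. \<lambda>n\<in>{..p}. \<Oplus>\<^bsub>G\<^esub>i\<in>{..n}. a i \<odot>\<^bsub>G\<^esub> x (n - i))\<rparr>"

definition trunc_twist :: "nat \<Rightarrow> ('v \<Rightarrow> 'v) \<Rightarrow> (nat \<Rightarrow> 'v) \<Rightarrow> nat \<Rightarrow> 'v" where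
  "trunc_twist p \<alpha> x = (\<lambda>n\<in>{..p}. \<alpha> (x n))"

text \<open>The bilinear extension of \<open>\<mu>\<^sub>t = \<mu>\<^sub>0 + t \<mu>\<^sub>1 + \<dots> + t\<^sup>p \<mu>\<^sub>p\<close>.\<close>

definition trunc_bracket ::
  "('k, 'v, 'b) module_scheme \<Rightarrow> nat \<Rightarrow> (nat \<Rightarrow> 'v list \<Rightarrow> 'v) \<Rightarrow>
   (nat \<Rightarrow> 'v) \<Rightarrow> (nat \<Rightarrow> 'v) \<Rightarrow> nat \<Rightarrow> 'v" where
  "trunc_bracket G p \<mu> x y = (\<lambda>n\<in>{..p}.
     finsum G (\<lambda>(i, j, k). \<mu> i [x j, y k]) {(i, j, k). i + j + k = n})"

definition order_deformation ::
  "('k, 'a) ring_scheme \<Rightarrow> ('k, 'v, 'b) module_scheme \<Rightarrow> ('v \<Rightarrow> 'v \<Rightarrow> 'v) \<Rightarrow>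
   ('v \<Rightarrow> 'v \<Rightarrow> 'v) \<Rightarrow> ('v \<Rightarrow> 'v) \<Rightarrow> nat \<Rightarrow>
   (nat \<Rightarrow> 'v list \<Rightarrow> 'v) \<Rightarrow> (nat \<Rightarrow> 'v list \<Rightarrow> 'v) \<Rightarrow> bool" where
  "order_deformation K G br\<^sub>1 br\<^sub>2 \<alpha> p \<mu>\<^sub>1 \<mu>\<^sub>2 \<longleftrightarrow>
     \<mu>\<^sub>1 \<in> {..p} \<rightarrow>\<^sub>E hom_cochains K G \<alpha> 2 \<and> \<mu>\<^sub>2 \<in> {..p} \<rightarrow>\<^sub>E hom_cochains K G \<alpha> 2 \<and>
     \<mu>\<^sub>1 0 = bracket_cochain G br\<^sub>1 \<and> \<mu>\<^sub>2 0 = bracket_cochain G br\<^sub>2 \<and>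
     compatible_hom_lie_algebra (trunc_ring K p) (trunc_module G p)
       (trunc_bracket G p \<mu>\<^sub>1) (trunc_bracket G p \<mu>\<^sub>2) (trunc_twist p \<alpha>)"

definition extensible ::
  "('k, 'a) ring_scheme \<Rightarrow> ('k, 'v, 'b) module_scheme \<Rightarrow> ('v \<Rightarrow> 'v \<Rightarrow> 'v) \<Rightarrow>
   ('v \<Rightarrow> 'v \<Rightarrow> 'v) \<Rightarrow> ('v \<Rightarrow> 'v) \<Rightarrow> nat \<Rightarrow>
   (nat \<Rightarrow> 'v list \<Rightarrow> 'v) \<Rightarrow> (nat \<Rightarrow> 'v list \<Rightarrow> 'v) \<Rightarrow> bool" where
  "extensible K G br\<^sub>1 br\<^sub>2 \<alpha> p \<mu>\<^sub>1 \<mu>\<^sub>2 \<longleftrightarrow>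
     (\<exists>\<nu>\<in>carrier (chom_cochain_group K G \<alpha> 2).
        order_deformation K G br\<^sub>1 br\<^sub>2 \<alpha> (p + 1) (\<mu>\<^sub>1(p + 1 := \<nu> 1)) (\<mu>\<^sub>2(p + 1 := \<nu> 2)))"

definition obstruction ::
  "('k, 'a) ring_scheme \<Rightarrow> ('k, 'v, 'b) module_scheme \<Rightarrow> ('v \<Rightarrow> 'v) \<Rightarrow> nat \<Rightarrow>
   (nat \<Rightarrow> 'v list \<Rightarrow> 'v) \<Rightarrow> (nat \<Rightarrow> 'v list \<Rightarrow> 'v) \<Rightarrow> nat \<Rightarrow> 'v list \<Rightarrow> 'v" where
  "obstruction K G \<alpha> p \<mu>\<^sub>1 \<mu>\<^sub>2 =
     (let half = inv\<^bsub>K\<^esub> (\<one>\<^bsub>K\<^esub> \<oplus>\<^bsub>K\<^esub> \<one>\<^bsub>K\<^esub>);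
          S = (\<lambda>\<mu> \<mu>' xs. \<Oplus>\<^bsub>G\<^esub>i\<in>{1..p}. nr_bracket G \<alpha> 1 1 (\<mu> i) (\<mu>' (p + 1 - i)) xs)
      in (\<lambda>s\<in>{1..3}. \<lambda>xs\<in>args G 3.
            if s = 1 then half \<odot>\<^bsub>G\<^esub> S \<mu>\<^sub>1 \<mu>\<^sub>1 xs
            else if s = 2 then S \<mu>\<^sub>1 \<mu>\<^sub>2 xs
            else half \<odot>\<^bsub>G\<^esub> S \<mu>\<^sub>2 \<mu>\<^sub>2 xs))"

end

theory Submission
  imports Defs
begin

text \<open>For two bilinear operations \<open>f, g\<close> write \<open>J(f, g)(x, y, z)\<close> for the cyclic sum of
  \<open>f (g x y) (\<alpha> z)\<close>, called \<open>jacobiator\<close> below. Everything in the theorem is a statement about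
  this one expression.

  A bilinear skew multiplicative bracket \<open>f\<close> is a Hom-Lie bracket iff \<open>J(f, f) = 0\<close>. Since \<open>J\<close> is
  bilinear in the pair of operations, all combinations of two Hom-Lie brackets \<open>f, g\<close> are
  Hom-Lie iff \<open>J(f, g) + J(g, f) = 0\<close> (\<open>compatible_iff_mixed_jacobi\<close>); this holds over any
  commutative ring, in particular over the truncated power series. By multilinearity the
  expression for \<open>\<mu>\<^sub>t\<close> and \<open>\<nu>\<^sub>t\<close> vanishes modulo \<open>t\<^sup>p\<^sup>+\<^sup>1\<close> iff each of its coefficients, the sum of
  \<open>J(\<mu>\<^sub>i, \<nu>\<^sub>j)\<close> over \<open>i + j = n\<close>, vanishes on constant arguments for \<open>n \<le> p\<close>. Hence a deformation
  of order \<open>p\<close> is the same as cochains that satisfy three families of equations indexed by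
  \<open>n \<le> p\<close> (\<open>order_deformation_iff\<close>).

  Adding terms in degree \<open>p + 1\<close> leaves the equations for \<open>n \<le> p\<close> untouched, so an extension
  exists iff the three equations for \<open>n = p + 1\<close> can be solved. In such an equation the terms with
  \<open>i = 0\<close> or \<open>j = 0\<close> contain the new cochains, and the others contain only the given ones. On
  cochains of degree two, \<open>P \<diamond> Q = J(P, Q)\<close>, and the coboundary of \<open>\<nu>\<close> is \<open>- J(\<mu>, \<nu>) - J(\<nu>, \<mu>)\<close>
  (\<open>nr_comp_eq_jacobiator\<close>, \<open>hom_delta_eq_jacobiators\<close>). The new terms thus form the negative of
  the total coboundary of the pair of new cochains, and the old ones form the obstruction cochain;
  the factor one half of the latter cancels because the sum over \<open>i + j = p + 1\<close> is symmetric.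
  So an extension by \<open>\<nu>\<close> exists iff the obstruction cochain is the coboundary of \<open>\<nu>\<close>
  (\<open>order_deformation_Suc_iff\<close>).

  Coboundaries form a subgroup \<open>B\<close>, and a coset of \<open>B\<close> equals \<open>B\<close> iff its representative lies in \<open>B\<close>
  (\<open>class_trivial_iff\<close>), which turns the last condition into the triviality of the class.\<close>

section \<open>Finite sums\<close>

text \<open>All rearrangements of convolution sums below are instances of this rule: an iterated sum is
  flattened along a bijection \<open>h\<close> from the pairs of outer and inner indices to the tuples with a
  fixed total degree.\<close>

lemma (in abelian_monoid) finsum_nested_reindex:
  assumes "finite A" and "\<And>a. a \<in> A \<Longrightarrow> finite (B a)"
    and h: "bij_betw h (Sigma A B) C"
    and F: "\<And>a. a \<in> A \<Longrightarrow> F a = (\<Oplus>b\<in>B a. g (h (a, b)))"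
    and g: "\<And>c. c \<in> C \<Longrightarrow> g c \<in> carrier G"
  shows "(\<Oplus>a\<in>A. F a) = (\<Oplus>c\<in>C. g c)"
proof -
  have inj: "inj_on h (Sigma A B)" and C: "C = h ` Sigma A B"
    using h by (auto simp: bij_betw_def)
  define D where "D a = h ` ({a} \<times> B a)" for a
  have CD: "C = (\<Union>a\<in>A. D a)" by (auto simp: C D_def)
  have gD: "g x \<in> carrier G" if "a \<in> A" "x \<in> D a" for a x
    using that g CD by blast
  have inner: "F a = (\<Oplus>c\<in>D a. g c)" if a: "a \<in> A" for a
  proof -
    have D: "D a = (\<lambda>b. h (a, b)) ` B a" by (auto simp: D_def)
    have "inj_on (\<lambda>b. h (a, b)) (B a)"
      using inj a by (auto simp: inj_on_def)
    then show ?thesis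
      unfolding F[OF a] D using gD[OF a] by (intro finsum_reindex[symmetric]) (auto simp: D)
  qed
  have "(\<Oplus>c\<in>C. g c) = (\<Oplus>a\<in>A. \<Oplus>c\<in>D a. g c)"
    unfolding CD
  proof (rule add.finprod_UN_disjoint)
    show "pairwise (\<lambda>i j. disjnt (D i) (D j)) A"
      using inj by (auto simp: pairwise_def disjnt_def D_def inj_on_def)
  qed (use assms gD in \<open>auto simp: D_def\<close>)
  also have "\<dots> = (\<Oplus>a\<in>A. F a)"
    using inner gD by (intro add.finprod_cong') auto
  finally show ?thesis by simp
qed

lemma (in abelian_monoid) finsum_bij:
  assumes h: "bij_betw h A C"
    and eq: "\<And>a. a \<in> A \<Longrightarrow> f a = g (h a)"
    and g: "\<And>c. c \<in> C \<Longrightarrow> g c \<in> carrier G"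
  shows "(\<Oplus>a\<in>A. f a) = (\<Oplus>c\<in>C. g c)"
proof -
  have "inj_on h A" "C = h ` A" using h by (auto simp: bij_betw_def)
  then have "(\<Oplus>c\<in>C. g c) = (\<Oplus>a\<in>A. g (h a))"
    using g by (auto intro: finsum_reindex)
  also have "\<dots> = (\<Oplus>a\<in>A. f a)"
    using g eq \<open>C = h ` A\<close> by (intro add.finprod_cong') auto
  finally show ?thesis by simp
qed

text \<open>Both sides are the sum of \<open>F i j k\<close> over \<open>i + j + k = n\<close>. This is the associativity of the
  Cauchy product, stated for an arbitrary summand so that it serves products of scalars as well
  as the action of scalars on vectors.\<close>

lemma (in abelian_monoid) convolution_assoc:
  fixes F :: "nat \<Rightarrow> nat \<Rightarrow> nat \<Rightarrow> 'a"
  assumes F: "\<And>i j k. i + j + k = n \<Longrightarrow> F i j k \<in> carrier G"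
  shows "(\<Oplus>s\<in>{..n}. \<Oplus>i\<in>{..s}. F i (s - i) (n - s))
       = (\<Oplus>i\<in>{..n}. \<Oplus>j\<in>{..n - i}. F i j (n - i - j))"
proof -
  let ?C = "{(i, j, k). i + j + k = n}" and ?g = "\<lambda>(i, j, k). F i j k"
  have "(\<Oplus>s\<in>{..n}. \<Oplus>i\<in>{..s}. F i (s - i) (n - s)) = finsum G ?g ?C"
    by (rule finsum_nested_reindex[where h = "\<lambda>(s, i). (i, s - i, n - s)" and B = "\<lambda>s. {..s}"])
      (auto intro!: bij_betw_byWitness[where f' = "\<lambda>(i, j, k). (i + j, i)"] F)
  also have "\<dots> = (\<Oplus>i\<in>{..n}. \<Oplus>j\<in>{..n - i}. F i j (n - i - j))"
    by (rule sym, rule finsum_nested_reindex[where h = "\<lambda>(i, j). (i, j, n - i - j)"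
          and B = "\<lambda>i. {..n - i}"])
      (auto intro!: bij_betw_byWitness[where f' = "\<lambda>(i, j, k). (i, j)"] F)
  finally show ?thesis .
qed

lemma (in abelian_monoid) convolution_commute:
  fixes F :: "nat \<Rightarrow> nat \<Rightarrow> 'a"
  assumes "\<And>i j. i + j = n \<Longrightarrow> F i j \<in> carrier G"
  shows "(\<Oplus>i\<in>{..n}. F i (n - i)) = (\<Oplus>i\<in>{..n}. F (n - i) i)"
  by (rule finsum_bij[where h = "\<lambda>i. n - i"])
    (auto intro!: bij_betw_byWitness[where f' = "\<lambda>i. n - i"] assms)

lemma (in abelian_monoid) finsum_single:
  assumes "finite A" "a \<in> A" "f a \<in> carrier G" and "\<And>b. b \<in> A \<Longrightarrow> b \<noteq> a \<Longrightarrow> f b = \<zero>"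
  shows "(\<Oplus>b\<in>A. f b) = f a"
proof -
  have "(\<Oplus>b\<in>{a}. f b) = (\<Oplus>b\<in>A. f b)"
    by (rule add.finprod_mono_neutral_cong_left) (use assms in \<open>auto simp: Pi_def; metis zero_closed\<close>)+
  with assms show ?thesis by simp
qed

lemma (in abelian_monoid) finsum_split_add:
  assumes "\<And>i. i \<in> A \<Longrightarrow> h i = f i \<oplus> g i"
    and "f \<in> A \<rightarrow> carrier G" "g \<in> A \<rightarrow> carrier G"
  shows "finsum G h A = finsum G f A \<oplus> finsum G g A"
proof -
  have "finsum G h A = (\<Oplus>i\<in>A. f i \<oplus> g i)"
    using assms by (intro add.finprod_cong') auto
  with assms show ?thesis by (simp add: finsum_addf)
qed

lemma (in abelian_group) finsum_neg:
  assumes "f \<in> A \<rightarrow> carrier G"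
  shows "(\<Oplus>a\<in>A. \<ominus> f a) = \<ominus> (\<Oplus>a\<in>A. f a)"
proof -
  have zero: "\<ominus> \<zero> = \<zero>" by (rule minus_equality) auto
  show ?thesis
    using assms by (induct A rule: infinite_finite_induct) (auto simp: Pi_def minus_add zero)
qed

section \<open>The truncated power series ring and module\<close>

context module
begin

lemma trunc_carrier:
  "x \<in> carrier (trunc_module M p) \<longleftrightarrow> (\<forall>n\<le>p. x n \<in> carrier M) \<and> x \<in> extensional {..p}"
  "a \<in> carrier (trunc_ring R p) \<longleftrightarrow> (\<forall>n\<le>p. a n \<in> carrier R) \<and> a \<in> extensional {..p}"
  by (auto simp: trunc_module_def trunc_ring_def PiE_iff)

lemma trunc_apply:
  assumes "n \<le> p"
  shows "(a \<otimes>\<^bsub>trunc_ring R p\<^esub> b) n = (\<Oplus>i\<in>{..n}. a i \<otimes> b (n - i))"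
    and "(a \<oplus>\<^bsub>trunc_ring R p\<^esub> b) n = a n \<oplus> b n"
    and "\<one>\<^bsub>trunc_ring R p\<^esub> n = (if n = 0 then \<one> else \<zero>)"
    and "(a \<odot>\<^bsub>trunc_module M p\<^esub> x) n = (\<Oplus>\<^bsub>M\<^esub>i\<in>{..n}. a i \<odot>\<^bsub>M\<^esub> x (n - i))"
    and "(x \<oplus>\<^bsub>trunc_module M p\<^esub> y) n = x n \<oplus>\<^bsub>M\<^esub> y n"
    and "\<zero>\<^bsub>trunc_module M p\<^esub> n = \<zero>\<^bsub>M\<^esub>"
  using assms by (simp_all add: trunc_ring_def trunc_module_def)

lemma trunc_ring_eqI:
  "\<lbrakk>a \<in> carrier (trunc_ring R p); b \<in> carrier (trunc_ring R p); \<And>n. n \<le> p \<Longrightarrow> a n = b n\<rbrakk> \<Longrightarrow> a = b"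
  by (rule extensionalityI[where A = "{..p}"]) (auto simp: trunc_carrier)

lemma trunc_module_eqI:
  "\<lbrakk>x \<in> carrier (trunc_module M p); y \<in> carrier (trunc_module M p); \<And>n. n \<le> p \<Longrightarrow> x n = y n\<rbrakk> \<Longrightarrow> x = y"
  by (rule extensionalityI[where A = "{..p}"]) (auto simp: trunc_carrier)

lemma trunc_ring_abelian_group: "abelian_group (trunc_ring R p)"
proof (rule abelian_groupI)
  fix x assume x: "x \<in> carrier (trunc_ring R p)"
  show "\<exists>y\<in>carrier (trunc_ring R p). y \<oplus>\<^bsub>trunc_ring R p\<^esub> x = \<zero>\<^bsub>trunc_ring R p\<^esub>"
    by (rule bexI[of _ "\<lambda>n\<in>{..p}. \<ominus> x n"])
      (use x in \<open>auto simp: trunc_ring_def PiE_iff R.l_neg\<close>)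
qed (auto simp: trunc_ring_def PiE_iff fun_eq_iff R.a_ac extensional_def)

lemma trunc_module_abelian_group: "abelian_group (trunc_module M p)"
proof (rule abelian_groupI)
  fix x assume x: "x \<in> carrier (trunc_module M p)"
  show "\<exists>y\<in>carrier (trunc_module M p). y \<oplus>\<^bsub>trunc_module M p\<^esub> x = \<zero>\<^bsub>trunc_module M p\<^esub>"
    by (rule bexI[of _ "\<lambda>n\<in>{..p}. \<ominus>\<^bsub>M\<^esub> x n"])
      (use x in \<open>auto simp: trunc_module_def PiE_iff M.l_neg\<close>)
qed (auto simp: trunc_module_def PiE_iff fun_eq_iff M.a_ac extensional_def)

lemma trunc_ring_cring: "cring (trunc_ring R p)"
proof -
  let ?T = "trunc_ring R p"
  interpret T: abelian_group ?T by (rule trunc_ring_abelian_group)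
  have mult_closed: "x \<otimes>\<^bsub>?T\<^esub> y \<in> carrier ?T" if "x \<in> carrier ?T" "y \<in> carrier ?T" for x y
    using that by (auto simp: trunc_ring_def PiE_iff)
  have one_closed: "\<one>\<^bsub>?T\<^esub> \<in> carrier ?T"
    by (auto simp: trunc_ring_def PiE_iff)
  have comm: "x \<otimes>\<^bsub>?T\<^esub> y = y \<otimes>\<^bsub>?T\<^esub> x"
    if x: "x \<in> carrier ?T" and y: "y \<in> carrier ?T" for x y
  proof (rule trunc_ring_eqI)
    fix n assume n: "n \<le> p"
    have "(\<Oplus>i\<in>{..n}. x i \<otimes> y (n - i)) = (\<Oplus>i\<in>{..n}. x (n - i) \<otimes> y i)"
      by (rule R.convolution_commute) (use x y n in \<open>auto simp: trunc_carrier\<close>)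
    also have "\<dots> = (\<Oplus>i\<in>{..n}. y i \<otimes> x (n - i))"
      by (rule R.add.finprod_cong') (use x y n in \<open>auto simp: trunc_carrier R.m_comm\<close>)
    finally show "(x \<otimes>\<^bsub>?T\<^esub> y) n = (y \<otimes>\<^bsub>?T\<^esub> x) n"
      by (simp add: trunc_apply n)
  qed (use x y in \<open>auto intro: mult_closed\<close>)
  have assoc: "x \<otimes>\<^bsub>?T\<^esub> y \<otimes>\<^bsub>?T\<^esub> z = x \<otimes>\<^bsub>?T\<^esub> (y \<otimes>\<^bsub>?T\<^esub> z)"
    if xyz: "x \<in> carrier ?T" "y \<in> carrier ?T" "z \<in> carrier ?T" for x y z
  proof (rule trunc_ring_eqI)
    fix n assume n: "n \<le> p"
    have "(x \<otimes>\<^bsub>?T\<^esub> y \<otimes>\<^bsub>?T\<^esub> z) n = (\<Oplus>s\<in>{..n}. (x \<otimes>\<^bsub>?T\<^esub> y) s \<otimes> z (n - s))"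
      by (simp add: trunc_apply n)
    also have "\<dots> = (\<Oplus>s\<in>{..n}. \<Oplus>i\<in>{..s}. x i \<otimes> (y (s - i) \<otimes> z (n - s)))"
      using xyz n by (intro R.add.finprod_cong') (auto simp: trunc_apply trunc_carrier
        R.finsum_ldistr R.m_assoc Pi_def intro!: R.add.finprod_cong')
    also have "\<dots> = (\<Oplus>i\<in>{..n}. \<Oplus>j\<in>{..n - i}. x i \<otimes> (y j \<otimes> z (n - i - j)))"
      by (rule R.convolution_assoc) (use xyz n in \<open>auto simp: trunc_carrier\<close>)
    also have "\<dots> = (\<Oplus>i\<in>{..n}. x i \<otimes> (y \<otimes>\<^bsub>?T\<^esub> z) (n - i))"
      using xyz n by (intro R.add.finprod_cong')
        (auto simp: trunc_apply trunc_carrier R.finsum_rdistr Pi_def)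
    also have "\<dots> = (x \<otimes>\<^bsub>?T\<^esub> (y \<otimes>\<^bsub>?T\<^esub> z)) n"
      by (simp add: trunc_apply n)
    finally show "(x \<otimes>\<^bsub>?T\<^esub> y \<otimes>\<^bsub>?T\<^esub> z) n = (x \<otimes>\<^bsub>?T\<^esub> (y \<otimes>\<^bsub>?T\<^esub> z)) n" .
  qed (use xyz in \<open>auto intro: mult_closed\<close>)
  have one: "\<one>\<^bsub>?T\<^esub> \<otimes>\<^bsub>?T\<^esub> x = x" if x: "x \<in> carrier ?T" for x
  proof (rule trunc_ring_eqI)
    fix n assume n: "n \<le> p"
    have "(\<one>\<^bsub>?T\<^esub> \<otimes>\<^bsub>?T\<^esub> x) n = (\<Oplus>i\<in>{..n}. \<one>\<^bsub>?T\<^esub> i \<otimes> x (n - i))"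
      by (simp add: trunc_apply n)
    also have "\<dots> = \<one>\<^bsub>?T\<^esub> 0 \<otimes> x (n - 0)"
      by (rule R.finsum_single) (use x n in \<open>auto simp: trunc_carrier trunc_apply\<close>)
    finally show "(\<one>\<^bsub>?T\<^esub> \<otimes>\<^bsub>?T\<^esub> x) n = x n"
      using x n by (simp add: trunc_apply trunc_carrier)
  qed (use x in \<open>auto intro: mult_closed one_closed\<close>)
  show ?thesis
  proof (rule cringI[OF trunc_ring_abelian_group])
    show "comm_monoid ?T"
      by (rule comm_monoidI) (fact mult_closed one_closed assoc one comm)+
  next
    fix x y z assume xyz: "x \<in> carrier ?T" "y \<in> carrier ?T" "z \<in> carrier ?T"
    show "(x \<oplus>\<^bsub>?T\<^esub> y) \<otimes>\<^bsub>?T\<^esub> z = x \<otimes>\<^bsub>?T\<^esub> z \<oplus>\<^bsub>?T\<^esub> y \<otimes>\<^bsub>?T\<^esub> z"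
    proof (rule trunc_ring_eqI)
      fix n assume n: "n \<le> p"
      show "((x \<oplus>\<^bsub>?T\<^esub> y) \<otimes>\<^bsub>?T\<^esub> z) n = (x \<otimes>\<^bsub>?T\<^esub> z \<oplus>\<^bsub>?T\<^esub> y \<otimes>\<^bsub>?T\<^esub> z) n"
        unfolding trunc_apply[OF n]
        by (rule R.finsum_split_add)
          (use xyz n in \<open>auto simp: trunc_carrier trunc_apply R.l_distr\<close>)
    qed (use xyz in \<open>auto intro: mult_closed\<close>)
  qed
qed

lemma trunc_module_module: "module (trunc_ring R p) (trunc_module M p)"
proof -
  let ?T = "trunc_ring R p" and ?M = "trunc_module M p"
  interpret T: cring ?T by (rule trunc_ring_cring)
  interpret N: abelian_group ?M by (rule trunc_module_abelian_group)
  have smult_T: "a \<odot>\<^bsub>?M\<^esub> x \<in> carrier ?M" if "a \<in> carrier ?T" "x \<in> carrier ?M" for a x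
    using that by (auto simp: trunc_ring_def trunc_module_def PiE_iff)
  have smult_sum: "finsum R f A \<odot>\<^bsub>M\<^esub> v = (\<Oplus>\<^bsub>M\<^esub>i\<in>A. f i \<odot>\<^bsub>M\<^esub> v)"
    if "f \<in> A \<rightarrow> carrier R" "v \<in> carrier M" for f and A :: "nat set" and v
    using that by (induct A rule: infinite_finite_induct) (auto simp: Pi_def smult_l_distr)
  show ?thesis
  proof (rule moduleI[OF trunc_ring_cring trunc_module_abelian_group smult_T])
    fix a b x assume abx: "a \<in> carrier ?T" "b \<in> carrier ?T" "x \<in> carrier ?M"
    show "(a \<oplus>\<^bsub>?T\<^esub> b) \<odot>\<^bsub>?M\<^esub> x = a \<odot>\<^bsub>?M\<^esub> x \<oplus>\<^bsub>?M\<^esub> b \<odot>\<^bsub>?M\<^esub> x"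
    proof (rule trunc_module_eqI)
      fix n assume n: "n \<le> p"
      show "((a \<oplus>\<^bsub>?T\<^esub> b) \<odot>\<^bsub>?M\<^esub> x) n = (a \<odot>\<^bsub>?M\<^esub> x \<oplus>\<^bsub>?M\<^esub> b \<odot>\<^bsub>?M\<^esub> x) n"
        unfolding trunc_apply[OF n]
        by (rule M.finsum_split_add)
          (use abx n in \<open>auto simp: trunc_carrier trunc_apply smult_l_distr\<close>)
    qed (use abx in \<open>auto intro: smult_T\<close>)
    show "(a \<otimes>\<^bsub>?T\<^esub> b) \<odot>\<^bsub>?M\<^esub> x = a \<odot>\<^bsub>?M\<^esub> (b \<odot>\<^bsub>?M\<^esub> x)"
    proof (rule trunc_module_eqI)
      fix n assume n: "n \<le> p"
      have "((a \<otimes>\<^bsub>?T\<^esub> b) \<odot>\<^bsub>?M\<^esub> x) n = (\<Oplus>\<^bsub>M\<^esub>s\<in>{..n}. (a \<otimes>\<^bsub>?T\<^esub> b) s \<odot>\<^bsub>M\<^esub> x (n - s))"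
        by (simp add: trunc_apply n)
      also have "\<dots> = (\<Oplus>\<^bsub>M\<^esub>s\<in>{..n}. \<Oplus>\<^bsub>M\<^esub>i\<in>{..s}. a i \<odot>\<^bsub>M\<^esub> (b (s - i) \<odot>\<^bsub>M\<^esub> x (n - s)))"
        using abx n by (intro M.add.finprod_cong') (auto simp: trunc_apply trunc_carrier
          smult_sum smult_assoc1 Pi_def intro!: M.add.finprod_cong')
      also have "\<dots> = (\<Oplus>\<^bsub>M\<^esub>i\<in>{..n}. \<Oplus>\<^bsub>M\<^esub>j\<in>{..n - i}. a i \<odot>\<^bsub>M\<^esub> (b j \<odot>\<^bsub>M\<^esub> x (n - i - j)))"
        by (rule M.convolution_assoc) (use abx n in \<open>auto simp: trunc_carrier\<close>)
      also have "\<dots> = (\<Oplus>\<^bsub>M\<^esub>i\<in>{..n}. a i \<odot>\<^bsub>M\<^esub> (b \<odot>\<^bsub>?M\<^esub> x) (n - i))"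
        using abx n by (intro M.add.finprod_cong')
          (auto simp: trunc_apply trunc_carrier finsum_smult_ldistr Pi_def)
      also have "\<dots> = (a \<odot>\<^bsub>?M\<^esub> (b \<odot>\<^bsub>?M\<^esub> x)) n"
        by (simp add: trunc_apply n)
      finally show "((a \<otimes>\<^bsub>?T\<^esub> b) \<odot>\<^bsub>?M\<^esub> x) n = (a \<odot>\<^bsub>?M\<^esub> (b \<odot>\<^bsub>?M\<^esub> x)) n" .
    qed (use abx in \<open>auto intro: smult_T\<close>)
  next
    fix a x y assume axy: "a \<in> carrier ?T" "x \<in> carrier ?M" "y \<in> carrier ?M"
    show "a \<odot>\<^bsub>?M\<^esub> (x \<oplus>\<^bsub>?M\<^esub> y) = a \<odot>\<^bsub>?M\<^esub> x \<oplus>\<^bsub>?M\<^esub> a \<odot>\<^bsub>?M\<^esub> y"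
    proof (rule trunc_module_eqI)
      fix n assume n: "n \<le> p"
      show "(a \<odot>\<^bsub>?M\<^esub> (x \<oplus>\<^bsub>?M\<^esub> y)) n = (a \<odot>\<^bsub>?M\<^esub> x \<oplus>\<^bsub>?M\<^esub> a \<odot>\<^bsub>?M\<^esub> y) n"
        unfolding trunc_apply[OF n]
        by (rule M.finsum_split_add)
          (use axy n in \<open>auto simp: trunc_carrier trunc_apply smult_r_distr\<close>)
    qed (use axy in \<open>auto intro: smult_T\<close>)
  next
    fix x assume x: "x \<in> carrier ?M"
    show "\<one>\<^bsub>?T\<^esub> \<odot>\<^bsub>?M\<^esub> x = x"
    proof (rule trunc_module_eqI)
      fix n assume n: "n \<le> p"
      have "(\<one>\<^bsub>?T\<^esub> \<odot>\<^bsub>?M\<^esub> x) n = (\<Oplus>\<^bsub>M\<^esub>i\<in>{..n}. \<one>\<^bsub>?T\<^esub> i \<odot>\<^bsub>M\<^esub> x (n - i))"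
        by (simp add: trunc_apply n)
      also have "\<dots> = \<one>\<^bsub>?T\<^esub> 0 \<odot>\<^bsub>M\<^esub> x (n - 0)"
        by (rule M.finsum_single) (use x n in \<open>auto simp: trunc_carrier trunc_apply\<close>)
      finally show "(\<one>\<^bsub>?T\<^esub> \<odot>\<^bsub>?M\<^esub> x) n = x n"
        using x n by (simp add: trunc_apply trunc_carrier)
    qed (use x in \<open>auto intro: smult_T\<close>)
  qed
qed

end

section \<open>Bilinear operations and the Hom-Jacobi expression\<close>

definition jacobiator ::
  "('r, 'v, 'b) module_scheme \<Rightarrow> ('v \<Rightarrow> 'v) \<Rightarrow> ('v \<Rightarrow> 'v \<Rightarrow> 'v) \<Rightarrow> ('v \<Rightarrow> 'v \<Rightarrow> 'v) \<Rightarrow> 'v \<Rightarrow> 'v \<Rightarrow> 'v \<Rightarrow> 'v" where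
  "jacobiator M \<alpha> f g x y z =
     f (g x y) (\<alpha> z) \<oplus>\<^bsub>M\<^esub> f (g y z) (\<alpha> x) \<oplus>\<^bsub>M\<^esub> f (g z x) (\<alpha> y)"

context module
begin

lemma module_endoD:
  assumes "module_endo R M f"
  shows "x \<in> carrier M \<Longrightarrow> f x \<in> carrier M"
    and "\<lbrakk>x \<in> carrier M; y \<in> carrier M\<rbrakk> \<Longrightarrow> f (x \<oplus>\<^bsub>M\<^esub> y) = f x \<oplus>\<^bsub>M\<^esub> f y"
    and "\<lbrakk>a \<in> carrier R; x \<in> carrier M\<rbrakk> \<Longrightarrow> f (a \<odot>\<^bsub>M\<^esub> x) = a \<odot>\<^bsub>M\<^esub> f x"
  using assms by (auto simp: module_endo_def)

lemma module_endo_zero: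
  assumes "module_endo R M f"
  shows "f \<zero>\<^bsub>M\<^esub> = \<zero>\<^bsub>M\<^esub>"
  using module_endoD(3)[OF assms, of \<zero> "\<zero>\<^bsub>M\<^esub>"] module_endoD(1)[OF assms, of "\<zero>\<^bsub>M\<^esub>"] by simp

lemma module_endo_finsum:
  assumes f: "module_endo R M f" and "g \<in> A \<rightarrow> carrier M"
  shows "f (finsum M g A) = (\<Oplus>\<^bsub>M\<^esub>a\<in>A. f (g a))"
  using assms(2)
  by (induct A rule: infinite_finite_induct)
    (auto simp: Pi_def module_endoD[OF f] module_endo_zero[OF f])

lemma bilinear_opD:
  assumes "bilinear_op R M f"
  shows "x \<in> carrier M \<Longrightarrow> module_endo R M (f x)"
    and "y \<in> carrier M \<Longrightarrow> module_endo R M (\<lambda>x. f x y)"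
  using assms by (auto simp: bilinear_op_def)

lemma bilinear_op_simps:
  assumes f: "bilinear_op R M f"
  shows "\<lbrakk>x \<in> carrier M; y \<in> carrier M\<rbrakk> \<Longrightarrow> f x y \<in> carrier M"
    and "\<lbrakk>x \<in> carrier M; y \<in> carrier M; z \<in> carrier M\<rbrakk> \<Longrightarrow> f (x \<oplus>\<^bsub>M\<^esub> y) z = f x z \<oplus>\<^bsub>M\<^esub> f y z"
    and "\<lbrakk>x \<in> carrier M; y \<in> carrier M; z \<in> carrier M\<rbrakk> \<Longrightarrow> f z (x \<oplus>\<^bsub>M\<^esub> y) = f z x \<oplus>\<^bsub>M\<^esub> f z y"
    and "\<lbrakk>a \<in> carrier R; x \<in> carrier M; y \<in> carrier M\<rbrakk> \<Longrightarrow> f (a \<odot>\<^bsub>M\<^esub> x) y = a \<odot>\<^bsub>M\<^esub> f x y"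
    and "\<lbrakk>a \<in> carrier R; x \<in> carrier M; y \<in> carrier M\<rbrakk> \<Longrightarrow> f x (a \<odot>\<^bsub>M\<^esub> y) = a \<odot>\<^bsub>M\<^esub> f x y"
    and "x \<in> carrier M \<Longrightarrow> f \<zero>\<^bsub>M\<^esub> x = \<zero>\<^bsub>M\<^esub>"
    and "x \<in> carrier M \<Longrightarrow> f x \<zero>\<^bsub>M\<^esub> = \<zero>\<^bsub>M\<^esub>"
  using module_endoD[OF bilinear_opD(1)[OF f]] module_endoD[OF bilinear_opD(2)[OF f]]
    module_endo_zero[OF bilinear_opD(1)[OF f]] module_endo_zero[OF bilinear_opD(2)[OF f]]
  by auto

text \<open>Skewness transports linearity from the first argument to the second.\<close>

lemma bilinear_opI_skew:
  assumes lin: "\<And>y. y \<in> carrier M \<Longrightarrow> module_endo R M (\<lambda>x. f x y)"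
    and skew: "\<And>x y. \<lbrakk>x \<in> carrier M; y \<in> carrier M\<rbrakk> \<Longrightarrow> f x y = \<ominus>\<^bsub>M\<^esub> f y x"
  shows "bilinear_op R M f"
  unfolding bilinear_op_def
proof (intro conjI ballI lin)
  fix x assume x: "x \<in> carrier M"
  note f = module_endoD[OF lin[OF x]]
  show "module_endo R M (f x)"
    unfolding module_endo_def
  proof (intro conjI ballI)
    show "f x \<in> carrier M \<rightarrow> carrier M"
    proof
      fix y assume y: "y \<in> carrier M"
      show "f x y \<in> carrier M"
        by (subst skew[OF x y]) (use f(1) y in simp)
    qed
  next
    fix y z assume "y \<in> carrier M" "z \<in> carrier M"
    then show "f x (y \<oplus>\<^bsub>M\<^esub> z) = f x y \<oplus>\<^bsub>M\<^esub> f x z"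
      using f x by (simp add: skew[of x] M.minus_add)
  next
    fix a y assume "a \<in> carrier R" "y \<in> carrier M"
    then show "f x (a \<odot>\<^bsub>M\<^esub> y) = a \<odot>\<^bsub>M\<^esub> f x y"
      using f x by (simp add: skew[of x] smult_r_minus)
  qed
qed

lemma jacobiator_closed:
  assumes "bilinear_op R M f" "bilinear_op R M g" "module_endo R M \<alpha>"
    and "x \<in> carrier M" "y \<in> carrier M" "z \<in> carrier M"
  shows "jacobiator M \<alpha> f g x y z \<in> carrier M"
  using assms by (simp add: jacobiator_def bilinear_op_simps module_endoD)

lemma hom_lie_algebra_iff:
  "hom_lie_algebra R M f \<alpha> \<longleftrightarrow>
     module_endo R M \<alpha> \<and> bilinear_op R M f \<and>
     (\<forall>x\<in>carrier M. \<forall>y\<in>carrier M. f x y = \<ominus>\<^bsub>M\<^esub> f y x) \<and>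
     (\<forall>x\<in>carrier M. \<forall>y\<in>carrier M. \<alpha> (f x y) = f (\<alpha> x) (\<alpha> y)) \<and>
     (\<forall>x\<in>carrier M. \<forall>y\<in>carrier M. \<forall>z\<in>carrier M. jacobiator M \<alpha> f f x y z = \<zero>\<^bsub>M\<^esub>)"
proof -
  have "module R M" ..
  then show ?thesis
    unfolding hom_lie_algebra_def hom_lie_algebra_axioms_def jacobiator_def by blast
qed

lemma smult_lcomm:
  "\<lbrakk>a \<in> carrier R; b \<in> carrier R; x \<in> carrier M\<rbrakk> \<Longrightarrow>
    a \<odot>\<^bsub>M\<^esub> (b \<odot>\<^bsub>M\<^esub> x) = b \<odot>\<^bsub>M\<^esub> (a \<odot>\<^bsub>M\<^esub> x)"
  by (simp add: smult_assoc1[symmetric] R.m_comm)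

text \<open>The expression \<open>J(h, h)\<close> is quadratic in \<open>h\<close>; its polarization is \<open>J(f, g) + J(g, f)\<close>.\<close>

lemma jacobiator_combination:
  assumes f: "bilinear_op R M f" and g: "bilinear_op R M g" and \<alpha>: "module_endo R M \<alpha>"
    and l: "l \<in> carrier R" and e: "e \<in> carrier R"
    and x: "x \<in> carrier M" and y: "y \<in> carrier M" and z: "z \<in> carrier M"
  defines "h \<equiv> \<lambda>x y. l \<odot>\<^bsub>M\<^esub> f x y \<oplus>\<^bsub>M\<^esub> e \<odot>\<^bsub>M\<^esub> g x y"
  shows "jacobiator M \<alpha> h h x y z =
    (l \<otimes> l) \<odot>\<^bsub>M\<^esub> jacobiator M \<alpha> f f x y z \<oplus>\<^bsub>M\<^esub>
    ((l \<otimes> e) \<odot>\<^bsub>M\<^esub> (jacobiator M \<alpha> f g x y z \<oplus>\<^bsub>M\<^esub> jacobiator M \<alpha> g f x y z) \<oplus>\<^bsub>M\<^esub>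
     (e \<otimes> e) \<odot>\<^bsub>M\<^esub> jacobiator M \<alpha> g g x y z)"
proof -
  note bil = bilinear_op_simps[OF f] bilinear_op_simps[OF g]
  have hh: "h (h u v) w = (l \<otimes> l) \<odot>\<^bsub>M\<^esub> f (f u v) w \<oplus>\<^bsub>M\<^esub>
      ((l \<otimes> e) \<odot>\<^bsub>M\<^esub> (f (g u v) w \<oplus>\<^bsub>M\<^esub> g (f u v) w) \<oplus>\<^bsub>M\<^esub> (e \<otimes> e) \<odot>\<^bsub>M\<^esub> g (g u v) w)"
    if uvw: "u \<in> carrier M" "v \<in> carrier M" "w \<in> carrier M" for u v w
  proof -
    have "h (h u v) w = ((l \<otimes> l) \<odot>\<^bsub>M\<^esub> f (f u v) w \<oplus>\<^bsub>M\<^esub> (l \<otimes> e) \<odot>\<^bsub>M\<^esub> f (g u v) w) \<oplus>\<^bsub>M\<^esub>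
       ((e \<otimes> l) \<odot>\<^bsub>M\<^esub> g (f u v) w \<oplus>\<^bsub>M\<^esub> (e \<otimes> e) \<odot>\<^bsub>M\<^esub> g (g u v) w)"
      using uvw l e unfolding h_def by (simp add: bil smult_r_distr smult_assoc1)
    also have "\<dots> = (l \<otimes> l) \<odot>\<^bsub>M\<^esub> f (f u v) w \<oplus>\<^bsub>M\<^esub>
      ((l \<otimes> e) \<odot>\<^bsub>M\<^esub> (f (g u v) w \<oplus>\<^bsub>M\<^esub> g (f u v) w) \<oplus>\<^bsub>M\<^esub> (e \<otimes> e) \<odot>\<^bsub>M\<^esub> g (g u v) w)"
      using uvw l e by (simp add: bil(1,8) smult_r_distr R.m_comm[of e l] M.a_assoc)
    finally show ?thesis .
  qed
  have regroup: "(p1 \<oplus>\<^bsub>M\<^esub> (q1 \<oplus>\<^bsub>M\<^esub> r1)) \<oplus>\<^bsub>M\<^esub> (p2 \<oplus>\<^bsub>M\<^esub> (q2 \<oplus>\<^bsub>M\<^esub> r2)) \<oplus>\<^bsub>M\<^esub> (p3 \<oplus>\<^bsub>M\<^esub> (q3 \<oplus>\<^bsub>M\<^esub> r3)) =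
      (p1 \<oplus>\<^bsub>M\<^esub> p2 \<oplus>\<^bsub>M\<^esub> p3) \<oplus>\<^bsub>M\<^esub> ((q1 \<oplus>\<^bsub>M\<^esub> q2 \<oplus>\<^bsub>M\<^esub> q3) \<oplus>\<^bsub>M\<^esub> (r1 \<oplus>\<^bsub>M\<^esub> r2 \<oplus>\<^bsub>M\<^esub> r3))"
    if "p1 \<in> carrier M" "p2 \<in> carrier M" "p3 \<in> carrier M" "q1 \<in> carrier M" "q2 \<in> carrier M"
      "q3 \<in> carrier M" "r1 \<in> carrier M" "r2 \<in> carrier M" "r3 \<in> carrier M"
    for p1 p2 p3 q1 q2 q3 r1 r2 r3
    using that by (simp add: M.a_ac)
  have sum2: "(x1 \<oplus>\<^bsub>M\<^esub> y1) \<oplus>\<^bsub>M\<^esub> (x2 \<oplus>\<^bsub>M\<^esub> y2) \<oplus>\<^bsub>M\<^esub> (x3 \<oplus>\<^bsub>M\<^esub> y3) =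
      (x1 \<oplus>\<^bsub>M\<^esub> x2 \<oplus>\<^bsub>M\<^esub> x3) \<oplus>\<^bsub>M\<^esub> (y1 \<oplus>\<^bsub>M\<^esub> y2 \<oplus>\<^bsub>M\<^esub> y3)"
    if "x1 \<in> carrier M" "x2 \<in> carrier M" "x3 \<in> carrier M"
      "y1 \<in> carrier M" "y2 \<in> carrier M" "y3 \<in> carrier M" for x1 x2 x3 y1 y2 y3
    using that by (simp add: M.a_ac)
  note c = module_endoD(1)[OF \<alpha>] bil(1,8)
  have "jacobiator M \<alpha> h h x y z =
      (l \<otimes> l) \<odot>\<^bsub>M\<^esub> jacobiator M \<alpha> f f x y z \<oplus>\<^bsub>M\<^esub>
      ((l \<otimes> e) \<odot>\<^bsub>M\<^esub> ((f (g x y) (\<alpha> z) \<oplus>\<^bsub>M\<^esub> g (f x y) (\<alpha> z)) \<oplus>\<^bsub>M\<^esub>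
          (f (g y z) (\<alpha> x) \<oplus>\<^bsub>M\<^esub> g (f y z) (\<alpha> x)) \<oplus>\<^bsub>M\<^esub> (f (g z x) (\<alpha> y) \<oplus>\<^bsub>M\<^esub> g (f z x) (\<alpha> y))) \<oplus>\<^bsub>M\<^esub>
       (e \<otimes> e) \<odot>\<^bsub>M\<^esub> jacobiator M \<alpha> g g x y z)"
    using x y z l e unfolding jacobiator_def
    by (subst (1 2 3) hh) (simp_all only: c M.a_closed R.m_closed smult_r_distr smult_closed regroup)
  then show ?thesis
    using x y z by (simp add: sum2 c jacobiator_def)
qed

text \<open>The squares in \<open>jacobiator_combination\<close> vanish by the two Hom-Jacobi identities, so only the
  mixed term remains, multiplied by \<open>l \<otimes> e\<close>. Taking \<open>l = e = 1\<close> shows that its vanishing is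
  necessary, over every commutative ring.\<close>

lemma compatible_iff_mixed_jacobi:
  assumes f: "hom_lie_algebra R M f \<alpha>" and g: "hom_lie_algebra R M g \<alpha>"
  shows "compatible_hom_lie_algebra R M f g \<alpha> \<longleftrightarrow>
    (\<forall>x\<in>carrier M. \<forall>y\<in>carrier M. \<forall>z\<in>carrier M.
       jacobiator M \<alpha> f g x y z \<oplus>\<^bsub>M\<^esub> jacobiator M \<alpha> g f x y z = \<zero>\<^bsub>M\<^esub>)"
    (is "_ \<longleftrightarrow> ?mixed")
proof -
  note F = f[unfolded hom_lie_algebra_iff] and G = g[unfolded hom_lie_algebra_iff]
  have \<alpha>: "module_endo R M \<alpha>" and bf: "bilinear_op R M f" and bg: "bilinear_op R M g"
    using F G by auto
  note c = module_endoD[OF \<alpha>] bilinear_op_simps[OF bf] bilinear_op_simps[OF bg]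
  let ?h = "\<lambda>l e x y. l \<odot>\<^bsub>M\<^esub> f x y \<oplus>\<^bsub>M\<^esub> e \<odot>\<^bsub>M\<^esub> g x y"
  have jac: "jacobiator M \<alpha> (?h l e) (?h l e) x y z =
     (l \<otimes> e) \<odot>\<^bsub>M\<^esub> (jacobiator M \<alpha> f g x y z \<oplus>\<^bsub>M\<^esub> jacobiator M \<alpha> g f x y z)"
    if "l \<in> carrier R" "e \<in> carrier R" "x \<in> carrier M" "y \<in> carrier M" "z \<in> carrier M" for l e x y z
  proof -
    have "jacobiator M \<alpha> f f x y z = \<zero>\<^bsub>M\<^esub>" "jacobiator M \<alpha> g g x y z = \<zero>\<^bsub>M\<^esub>"
      using that F G by blast+
    then show ?thesis
      using that bf bg \<alpha> by (simp add: jacobiator_combination jacobiator_closed)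
  qed
  have bil: "bilinear_op R M (?h l e)" if "l \<in> carrier R" "e \<in> carrier R" for l e
    using that unfolding bilinear_op_def module_endo_def
    by (intro conjI ballI) (simp_all add: c smult_r_distr M.a_ac smult_lcomm)
  have lie: "hom_lie_algebra R M (?h l e) \<alpha> \<longleftrightarrow> (\<forall>x\<in>carrier M. \<forall>y\<in>carrier M. \<forall>z\<in>carrier M.
      (l \<otimes> e) \<odot>\<^bsub>M\<^esub> (jacobiator M \<alpha> f g x y z \<oplus>\<^bsub>M\<^esub> jacobiator M \<alpha> g f x y z) = \<zero>\<^bsub>M\<^esub>)"
    if le: "l \<in> carrier R" "e \<in> carrier R" for l e
  proof -
    have "?h l e x y = \<ominus>\<^bsub>M\<^esub> ?h l e y x" if "x \<in> carrier M" "y \<in> carrier M" for x y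
    proof -
      have "f x y = \<ominus>\<^bsub>M\<^esub> f y x" "g x y = \<ominus>\<^bsub>M\<^esub> g y x" using F G that by blast+
      then show ?thesis using that le by (simp add: c smult_r_minus M.minus_add)
    qed
    moreover have "\<alpha> (?h l e x y) = ?h l e (\<alpha> x) (\<alpha> y)" if "x \<in> carrier M" "y \<in> carrier M" for x y
    proof -
      have "\<alpha> (f x y) = f (\<alpha> x) (\<alpha> y)" "\<alpha> (g x y) = g (\<alpha> x) (\<alpha> y)" using F G that by blast+
      then show ?thesis using that le by (simp add: c)
    qed
    moreover have "(\<forall>x\<in>carrier M. \<forall>y\<in>carrier M. \<forall>z\<in>carrier M.
        jacobiator M \<alpha> (?h l e) (?h l e) x y z = \<zero>\<^bsub>M\<^esub>) \<longleftrightarrow>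
      (\<forall>x\<in>carrier M. \<forall>y\<in>carrier M. \<forall>z\<in>carrier M.
        (l \<otimes> e) \<odot>\<^bsub>M\<^esub> (jacobiator M \<alpha> f g x y z \<oplus>\<^bsub>M\<^esub> jacobiator M \<alpha> g f x y z) = \<zero>\<^bsub>M\<^esub>)"
      using jac[OF le] by simp
    ultimately show ?thesis
      unfolding hom_lie_algebra_iff using \<alpha> bil[OF le] by blast
  qed
  show ?thesis
  proof
    assume "compatible_hom_lie_algebra R M f g \<alpha>"
    then have "hom_lie_algebra R M (?h \<one> \<one>) \<alpha>"
      by (rule compatible_hom_lie_algebra.compatible) auto
    then show ?mixed
      using bf bg \<alpha> by (simp add: lie jacobiator_closed)
  next
    assume ?mixed
    then have "hom_lie_algebra R M (?h l e) \<alpha>" if "l \<in> carrier R" "e \<in> carrier R" for l e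
      using that by (simp add: lie)
    then show "compatible_hom_lie_algebra R M f g \<alpha>"
      using f g by (simp add: compatible_hom_lie_algebra_def compatible_hom_lie_algebra_axioms_def)
  qed
qed

end

section \<open>Brackets of truncated power series\<close>

definition cochain_op :: "('v list \<Rightarrow> 'v) \<Rightarrow> 'v \<Rightarrow> 'v \<Rightarrow> 'v" where
  "cochain_op \<mu> x y = \<mu> [x, y]"

lemma finite_sum_tuples:
  "finite {(i, j, k). i + j + k = (n::nat)}"
  "finite {(m, a, b, c). m + a + b + c = (n::nat)}"
  "finite {(i, j, a, b, c). i + j + a + b + c = (n::nat)}"
proof -
  show "finite {(i, j, k). i + j + k = (n::nat)}"
    by (rule finite_subset[of _ "{..n} \<times> {..n} \<times> {..n}"]) auto
  show "finite {(m, a, b, c). m + a + b + c = (n::nat)}"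
    by (rule finite_subset[of _ "{..n} \<times> {..n} \<times> {..n} \<times> {..n}"]) auto
  show "finite {(i, j, a, b, c). i + j + a + b + c = (n::nat)}"
    by (rule finite_subset[of _ "{..n} \<times> {..n} \<times> {..n} \<times> {..n} \<times> {..n}"]) auto
qed

text \<open>The coefficient of \<open>t\<^sup>n\<close> in \<open>J(\<mu>\<^sub>t, \<nu>\<^sub>t)(x, y, z)\<close> for constant \<open>x, y, z\<close>.\<close>

definition jacobi_coeff ::
  "('r, 'v, 'b) module_scheme \<Rightarrow> ('v \<Rightarrow> 'v) \<Rightarrow> (nat \<Rightarrow> 'v list \<Rightarrow> 'v) \<Rightarrow> (nat \<Rightarrow> 'v list \<Rightarrow> 'v) \<Rightarrow>
   nat \<Rightarrow> 'v \<Rightarrow> 'v \<Rightarrow> 'v \<Rightarrow> 'v" where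
  "jacobi_coeff M \<alpha> \<mu> \<nu> n x y z =
     (\<Oplus>\<^bsub>M\<^esub>i\<in>{..n}. jacobiator M \<alpha> (cochain_op (\<mu> i)) (cochain_op (\<nu> (n - i))) x y z)"

context module
begin

lemma args2: "[x, y] \<in> args M 2 \<longleftrightarrow> x \<in> carrier M \<and> y \<in> carrier M"
  by (auto simp: args_def)

lemma cochain_op_endo:
  assumes \<mu>: "\<mu> \<in> hom_cochains R M \<alpha> 2" and y: "y \<in> carrier M"
  shows "module_endo R M (\<lambda>x. cochain_op \<mu> x y)" and "module_endo R M (cochain_op \<mu> y)"
proof -
  have *: "module_endo R M (\<lambda>x. \<mu> ([y, y][i := x]))" if "i < 2" for i
    using \<mu> y that args2 unfolding hom_cochains_def by blast
  show "module_endo R M (\<lambda>x. cochain_op \<mu> x y)" "module_endo R M (cochain_op \<mu> y)"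
    using *[of 0] *[of 1] by (simp_all add: cochain_op_def[abs_def])
qed

lemma cochain_op_bilinear:
  assumes "\<mu> \<in> hom_cochains R M \<alpha> 2"
  shows "bilinear_op R M (cochain_op \<mu>)"
  using cochain_op_endo[OF assms] by (simp add: bilinear_op_def)

text \<open>The usual polarization: expand the value \<open>0\<close> at the arguments \<open>x + y, x + y\<close>.\<close>

lemma cochain_op_skew:
  assumes \<mu>: "\<mu> \<in> hom_cochains R M \<alpha> 2" and xy: "x \<in> carrier M" "y \<in> carrier M"
  shows "cochain_op \<mu> x y = \<ominus>\<^bsub>M\<^esub> cochain_op \<mu> y x"
proof -
  note b = bilinear_op_simps[OF cochain_op_bilinear[OF \<mu>]]
  have alt: "cochain_op \<mu> u u = \<zero>\<^bsub>M\<^esub>" if "u \<in> carrier M" for u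
  proof -
    have "[u, u] \<in> args M 2" "(0::nat) < 2" "(1::nat) < 2" "(0::nat) \<noteq> 1" "[u, u] ! 0 = [u, u] ! 1"
      using that by (auto simp: args2)
    then show ?thesis using \<mu> unfolding hom_cochains_def cochain_op_def by blast
  qed
  have "\<zero>\<^bsub>M\<^esub> = cochain_op \<mu> (x \<oplus>\<^bsub>M\<^esub> y) (x \<oplus>\<^bsub>M\<^esub> y)"
    using xy alt by simp
  also have "\<dots> = (cochain_op \<mu> x x \<oplus>\<^bsub>M\<^esub> cochain_op \<mu> y x) \<oplus>\<^bsub>M\<^esub>
      (cochain_op \<mu> x y \<oplus>\<^bsub>M\<^esub> cochain_op \<mu> y y)"
    using xy by (simp only: b M.a_closed)
  also have "\<dots> = cochain_op \<mu> y x \<oplus>\<^bsub>M\<^esub> cochain_op \<mu> x y"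
    using xy by (simp add: b alt)
  also have "\<dots> = cochain_op \<mu> x y \<oplus>\<^bsub>M\<^esub> cochain_op \<mu> y x"
    using xy by (simp add: b M.a_comm)
  finally show ?thesis
    using xy by (metis b(1) M.minus_equality)
qed

lemma cochain_op_twist:
  assumes \<mu>: "\<mu> \<in> hom_cochains R M \<alpha> 2" and xy: "x \<in> carrier M" "y \<in> carrier M"
  shows "\<alpha> (cochain_op \<mu> x y) = cochain_op \<mu> (\<alpha> x) (\<alpha> y)"
proof -
  have "\<forall>xs\<in>args M 2. \<alpha> (\<mu> xs) = \<mu> (map \<alpha> xs)"
    using \<mu> by (simp add: hom_cochains_def)
  from bspec[OF this, of "[x, y]"] xy show ?thesis by (simp add: cochain_op_def args2)
qed

lemma trunc_bracket_apply:
  "n \<le> p \<Longrightarrow> trunc_bracket M p \<mu> X Y n =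
     finsum M (\<lambda>(i, j, k). cochain_op (\<mu> i) (X j) (Y k)) {(i, j, k). i + j + k = n}"
  by (simp add: trunc_bracket_def cochain_op_def)

lemma trunc_twist_endo:
  assumes \<alpha>: "module_endo R M \<alpha>"
  shows "module_endo (trunc_ring R p) (trunc_module M p) (trunc_twist p \<alpha>)"
  unfolding module_endo_def
proof (intro conjI ballI)
  interpret T: module "trunc_ring R p" "trunc_module M p" by (rule trunc_module_module)
  let ?\<alpha> = "trunc_twist p \<alpha>"
  note c = module_endoD[OF \<alpha>]
  have closed: "?\<alpha> x \<in> carrier (trunc_module M p)" if "x \<in> carrier (trunc_module M p)" for x
    using that c by (auto simp: trunc_carrier trunc_twist_def)
  then show "?\<alpha> \<in> carrier (trunc_module M p) \<rightarrow> carrier (trunc_module M p)" by auto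
  show "?\<alpha> (x \<oplus>\<^bsub>trunc_module M p\<^esub> y) = ?\<alpha> x \<oplus>\<^bsub>trunc_module M p\<^esub> ?\<alpha> y"
    if "x \<in> carrier (trunc_module M p)" "y \<in> carrier (trunc_module M p)" for x y
  proof (rule trunc_module_eqI[where p = p])
    show "?\<alpha> (x \<oplus>\<^bsub>trunc_module M p\<^esub> y) n = (?\<alpha> x \<oplus>\<^bsub>trunc_module M p\<^esub> ?\<alpha> y) n" if "n \<le> p" for n
      using that \<open>x \<in> _\<close> \<open>y \<in> _\<close> c by (simp add: trunc_carrier trunc_apply trunc_twist_def)
  qed (use that closed in auto)
  show "?\<alpha> (a \<odot>\<^bsub>trunc_module M p\<^esub> x) = a \<odot>\<^bsub>trunc_module M p\<^esub> ?\<alpha> x"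
    if a: "a \<in> carrier (trunc_ring R p)" and x: "x \<in> carrier (trunc_module M p)" for a x
  proof (rule trunc_module_eqI[where p = p])
    fix n assume n: "n \<le> p"
    then have "?\<alpha> (a \<odot>\<^bsub>trunc_module M p\<^esub> x) n = \<alpha> (\<Oplus>\<^bsub>M\<^esub>i\<in>{..n}. a i \<odot>\<^bsub>M\<^esub> x (n - i))"
      by (simp add: trunc_twist_def trunc_apply)
    also have "\<dots> = (\<Oplus>\<^bsub>M\<^esub>i\<in>{..n}. \<alpha> (a i \<odot>\<^bsub>M\<^esub> x (n - i)))"
      using a x n by (intro module_endo_finsum[OF \<alpha>]) (auto simp: trunc_carrier)
    also have "\<dots> = (\<Oplus>\<^bsub>M\<^esub>i\<in>{..n}. a i \<odot>\<^bsub>M\<^esub> ?\<alpha> x (n - i))"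
      using a x n c
      by (intro M.add.finprod_cong') (auto simp: trunc_carrier trunc_twist_def)
    finally show "?\<alpha> (a \<odot>\<^bsub>trunc_module M p\<^esub> x) n = (a \<odot>\<^bsub>trunc_module M p\<^esub> ?\<alpha> x) n"
      using n by (simp add: trunc_apply)
  qed (use a x closed in auto)
qed

end

locale cochain_family = module R M
  for R :: "('r, 'a) ring_scheme" (structure) and M :: "('r, 'v, 'b) module_scheme" (structure) +
  fixes \<alpha> :: "'v \<Rightarrow> 'v" and p :: nat and \<mu> :: "nat \<Rightarrow> 'v list \<Rightarrow> 'v"
  assumes twist: "module_endo R M \<alpha>"
    and cochain: "i \<le> p \<Longrightarrow> \<mu> i \<in> hom_cochains R M \<alpha> 2"
begin

lemma op_bilinear: "i \<le> p \<Longrightarrow> bilinear_op R M (cochain_op (\<mu> i))"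
  by (rule cochain_op_bilinear[OF cochain])

lemmas op_simps = bilinear_op_simps[OF op_bilinear]
lemmas op_skew = cochain_op_skew[OF cochain]
lemmas op_twist = cochain_op_twist[OF cochain]

abbreviation "T \<equiv> trunc_ring R p"
abbreviation "N \<equiv> trunc_module M p"
abbreviation "br \<equiv> trunc_bracket M p \<mu>"

lemma trunc_bracket_closed:
  assumes "X \<in> carrier N" "Y \<in> carrier N"
  shows "br X Y \<in> carrier N"
proof -
  have "br X Y n \<in> carrier M" if "n \<le> p" for n
    unfolding trunc_bracket_apply[OF that]
    using assms that by (intro M.finsum_closed) (auto simp: trunc_carrier op_simps)
  then show ?thesis by (simp add: trunc_carrier) (simp add: trunc_bracket_def)
qed

lemma trunc_bracket_skew:
  assumes X: "X \<in> carrier N" and Y: "Y \<in> carrier N"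
  shows "br X Y = \<ominus>\<^bsub>N\<^esub> br Y X"
proof -
  interpret T: module T N by (rule trunc_module_module)
  have "br X Y \<oplus>\<^bsub>N\<^esub> br Y X = \<zero>\<^bsub>N\<^esub>"
  proof (rule trunc_module_eqI[where p = p])
    fix n assume n: "n \<le> p"
    let ?C = "{(i, j, k). i + j + k = n}"
    have "br X Y n = finsum M (\<lambda>(i, j, k). \<ominus>\<^bsub>M\<^esub> cochain_op (\<mu> i) (Y j) (X k)) ?C"
      unfolding trunc_bracket_apply[OF n]
      by (rule M.finsum_bij[where h = "\<lambda>(i, j, k). (i, k, j)"])
        (use X Y n in \<open>auto simp: trunc_carrier op_simps intro: op_skew
          intro!: bij_betw_byWitness[where f' = "\<lambda>(i, j, k). (i, k, j)"]\<close>)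
    also have "\<dots> = (\<Oplus>\<^bsub>M\<^esub>c\<in>?C. \<ominus>\<^bsub>M\<^esub> (case c of (i, j, k) \<Rightarrow> cochain_op (\<mu> i) (Y j) (X k)))"
      by (simp add: case_prod_beta')
    also have "\<dots> = \<ominus>\<^bsub>M\<^esub> br Y X n"
      unfolding trunc_bracket_apply[OF n]
      by (rule M.finsum_neg) (use X Y n in \<open>auto simp: trunc_carrier op_simps\<close>)
    finally show "(br X Y \<oplus>\<^bsub>N\<^esub> br Y X) n = \<zero>\<^bsub>N\<^esub> n"
      using n trunc_bracket_closed[OF Y X] by (simp add: trunc_apply trunc_carrier M.l_neg)
  qed (use X Y trunc_bracket_closed in auto)
  then show ?thesis
    using X Y trunc_bracket_closed by (metis T.M.minus_equality)
qed

text \<open>Only linearity over the truncated scalars in the first argument needs work: both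
  \<open>br (a X) Z\<close> and \<open>a br X Z\<close> have as coefficient of \<open>t\<^sup>n\<close> the sum of \<open>a\<^sub>l \<mu>\<^sub>i(X\<^sub>j, Z\<^sub>k)\<close> over
  \<open>l + i + j + k = n\<close>.\<close>

lemma trunc_bracket_bilinear: "bilinear_op T N br"
proof -
  interpret T: module T N by (rule trunc_module_module)
  show ?thesis
  proof (rule T.bilinear_opI_skew)
    fix Z assume Z: "Z \<in> carrier N"
    show "module_endo T N (\<lambda>X. br X Z)"
      unfolding module_endo_def
    proof (intro conjI ballI)
      show "(\<lambda>X. br X Z) \<in> carrier N \<rightarrow> carrier N"
        using Z trunc_bracket_closed by auto
    next
      fix X Y assume XY: "X \<in> carrier N" "Y \<in> carrier N"
      show "br (X \<oplus>\<^bsub>N\<^esub> Y) Z = br X Z \<oplus>\<^bsub>N\<^esub> br Y Z"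
      proof (rule trunc_module_eqI[where p = p])
        fix n assume n: "n \<le> p"
        have "br (X \<oplus>\<^bsub>N\<^esub> Y) Z n = br X Z n \<oplus>\<^bsub>M\<^esub> br Y Z n"
          unfolding trunc_bracket_apply[OF n]
          by (rule M.finsum_split_add)
            (use XY Z n in \<open>auto simp: trunc_carrier trunc_apply op_simps\<close>)
        then show "br (X \<oplus>\<^bsub>N\<^esub> Y) Z n = (br X Z \<oplus>\<^bsub>N\<^esub> br Y Z) n"
          by (simp add: trunc_apply n)
      qed (use XY Z trunc_bracket_closed in auto)
    next
      fix a X assume a: "a \<in> carrier T" and X: "X \<in> carrier N"
      show "br (a \<odot>\<^bsub>N\<^esub> X) Z = a \<odot>\<^bsub>N\<^esub> br X Z"
      proof (rule trunc_module_eqI[where p = p])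
        fix n assume n: "n \<le> p"
        let ?C = "{(l, i, j, k). l + i + j + k = n}"
        let ?g = "\<lambda>(l, i, j, k). a l \<odot>\<^bsub>M\<^esub> cochain_op (\<mu> i) (X j) (Z k)"
        have "br (a \<odot>\<^bsub>N\<^esub> X) Z n = finsum M ?g ?C"
          unfolding trunc_bracket_apply[OF n]
        proof (rule M.finsum_nested_reindex[where B = "\<lambda>(i, j, k). {..j}"
              and h = "\<lambda>((i, j, k), l). (l, i, j - l, k)"])
          fix c assume "c \<in> {(i, j, k). i + j + k = n}"
          then obtain i j k where c: "c = (i, j, k)" "i + j + k = n" by auto
          have "cochain_op (\<mu> i) ((a \<odot>\<^bsub>N\<^esub> X) j) (Z k) =
              cochain_op (\<mu> i) (\<Oplus>\<^bsub>M\<^esub>l\<in>{..j}. a l \<odot>\<^bsub>M\<^esub> X (j - l)) (Z k)"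
            using c n by (simp add: trunc_apply)
          also have "\<dots> = (\<Oplus>\<^bsub>M\<^esub>l\<in>{..j}. cochain_op (\<mu> i) (a l \<odot>\<^bsub>M\<^esub> X (j - l)) (Z k))"
            using a X Z n c
            by (intro module_endo_finsum[OF bilinear_opD(2)[OF op_bilinear]])
              (auto simp: trunc_carrier)
          also have "\<dots> = (\<Oplus>\<^bsub>M\<^esub>l\<in>{..j}. a l \<odot>\<^bsub>M\<^esub> cochain_op (\<mu> i) (X (j - l)) (Z k))"
            using a X Z n c by (intro M.add.finprod_cong') (auto simp: trunc_carrier op_simps)
          finally show "(case c of (i, j, k) \<Rightarrow> cochain_op (\<mu> i) ((a \<odot>\<^bsub>N\<^esub> X) j) (Z k)) =
              (\<Oplus>\<^bsub>M\<^esub>l\<in>(case c of (i, j, k) \<Rightarrow> {..j}). ?g ((\<lambda>((i, j, k), l). (l, i, j - l, k)) (c, l)))"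
            by (simp add: c)
        qed (use a X Z n in \<open>auto simp: trunc_carrier op_simps finite_sum_tuples
            intro!: bij_betw_byWitness[where f' = "\<lambda>(l, i, j, k). ((i, j + l, k), l)"]\<close>)
        also have "\<dots> = (a \<odot>\<^bsub>N\<^esub> br X Z) n"
          unfolding trunc_apply[OF n]
        proof (rule sym, rule M.finsum_nested_reindex[where B = "\<lambda>l. {(i, j, k). i + j + k = n - l}"
              and h = "\<lambda>(l, c). (l, c)"])
          fix l assume l: "l \<in> {..n}"
          have "a l \<odot>\<^bsub>M\<^esub> br X Z (n - l) = (\<Oplus>\<^bsub>M\<^esub>c\<in>{(i, j, k). i + j + k = n - l}.
              a l \<odot>\<^bsub>M\<^esub> (case c of (i, j, k) \<Rightarrow> cochain_op (\<mu> i) (X j) (Z k)))"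
            using a X Z n l by (subst trunc_bracket_apply, simp, subst finsum_smult_ldistr)
              (auto simp: trunc_carrier op_simps finite_sum_tuples)
          then show "a l \<odot>\<^bsub>M\<^esub> br X Z (n - l) = (\<Oplus>\<^bsub>M\<^esub>c\<in>{(i, j, k). i + j + k = n - l}.
              ?g ((\<lambda>(l, c). (l, c)) (l, c)))"
            by (simp add: case_prod_beta')
        qed (use a X Z n in \<open>auto simp: trunc_carrier op_simps finite_sum_tuples
            intro!: bij_betw_byWitness[where f' = "\<lambda>c. c"]\<close>)
        finally show "br (a \<odot>\<^bsub>N\<^esub> X) Z n = (a \<odot>\<^bsub>N\<^esub> br X Z) n" .
      qed (use a X Z trunc_bracket_closed in auto)
    qed
  qed (rule trunc_bracket_skew)
qed

lemma trunc_bracket_multiplicative: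
  assumes X: "X \<in> carrier N" and Y: "Y \<in> carrier N"
  shows "trunc_twist p \<alpha> (br X Y) = br (trunc_twist p \<alpha> X) (trunc_twist p \<alpha> Y)"
proof (rule trunc_module_eqI[where p = p])
  interpret T: module T N by (rule trunc_module_module)
  note c = T.module_endoD(1)[OF trunc_twist_endo[OF twist]]
  show "trunc_twist p \<alpha> (br X Y) \<in> carrier N"
    and "br (trunc_twist p \<alpha> X) (trunc_twist p \<alpha> Y) \<in> carrier N"
    using X Y trunc_bracket_closed c by auto
  fix n assume n: "n \<le> p"
  let ?C = "{(i, j, k). i + j + k = n}"
  have "trunc_twist p \<alpha> (br X Y) n =
      (\<Oplus>\<^bsub>M\<^esub>c\<in>?C. \<alpha> (case c of (i, j, k) \<Rightarrow> cochain_op (\<mu> i) (X j) (Y k)))"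
    using X Y n by (simp add: trunc_twist_def trunc_bracket_apply, intro module_endo_finsum[OF twist])
      (auto simp: trunc_carrier op_simps)
  also have "\<dots> = br (trunc_twist p \<alpha> X) (trunc_twist p \<alpha> Y) n"
    unfolding trunc_bracket_apply[OF n] using X Y n module_endoD(1)[OF twist]
    by (intro M.add.finprod_cong') (auto simp: trunc_carrier op_simps op_twist trunc_twist_def)
  finally show "trunc_twist p \<alpha> (br X Y) n = br (trunc_twist p \<alpha> X) (trunc_twist p \<alpha> Y) n" .
qed

end

section \<open>Coefficients of the Hom-Jacobi expression\<close>

locale cochain_family_pair =
  first: cochain_family R M \<alpha> p \<mu> + second: cochain_family R M \<alpha> p \<nu>
  for R :: "('r, 'a) ring_scheme" (structure) and M :: "('r, 'v, 'b) module_scheme" (structure)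
    and \<alpha> :: "'v \<Rightarrow> 'v" and p :: nat and \<mu> \<nu> :: "nat \<Rightarrow> 'v list \<Rightarrow> 'v"
begin

abbreviation "N \<equiv> trunc_module M p"
abbreviation "J \<equiv> jacobiator N (trunc_twist p \<alpha>) (trunc_bracket M p \<mu>) (trunc_bracket M p \<nu>)"

lemma term_closed:
  assumes "i \<le> p" "j \<le> p" "x \<in> carrier M" "y \<in> carrier M" "z \<in> carrier M"
  shows "cochain_op (\<mu> i) (cochain_op (\<nu> j) x y) (\<alpha> z) \<in> carrier M"
  using assms first.op_simps(1) second.op_simps(1) first.module_endoD(1)[OF first.twist] by simp

lemma nested_bracket_apply:
  assumes X: "X \<in> carrier N" and Y: "Y \<in> carrier N" and Z: "Z \<in> carrier N" and n: "n \<le> p"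
  shows "trunc_bracket M p \<mu> (trunc_bracket M p \<nu> X Y) (trunc_twist p \<alpha> Z) n =
    finsum M (\<lambda>(i, j, a, b, c). cochain_op (\<mu> i) (cochain_op (\<nu> j) (X a) (Y b)) (\<alpha> (Z c)))
      {(i, j, a, b, c). i + j + a + b + c = n}"
    (is "_ = finsum M ?g ?C")
  unfolding first.trunc_bracket_apply[OF n]
proof (rule first.M.finsum_nested_reindex[where B = "\<lambda>(i, s, c). {(j, a, b). j + a + b = s}"
      and h = "\<lambda>((i, s, c), (j, a, b)). (i, j, a, b, c)"])
  fix d assume "d \<in> {(i, s, c). i + s + c = n}"
  then obtain i s c where d: "d = (i, s, c)" "i + s + c = n" by auto
  note \<alpha> = first.module_endoD(1)[OF first.twist]
  have "cochain_op (\<mu> i) (trunc_bracket M p \<nu> X Y s) (\<alpha> (Z c)) =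
     (\<Oplus>\<^bsub>M\<^esub>e\<in>{(j, a, b). j + a + b = s}. cochain_op (\<mu> i)
        (case e of (j, a, b) \<Rightarrow> cochain_op (\<nu> j) (X a) (Y b)) (\<alpha> (Z c)))"
    using X Y Z n d by (subst first.trunc_bracket_apply, simp)
      (intro first.module_endo_finsum[OF first.bilinear_opD(2)[OF first.op_bilinear]],
        auto simp: first.trunc_carrier second.op_simps \<alpha>)
  then show "(case d of (i, j, k) \<Rightarrow> cochain_op (\<mu> i) (trunc_bracket M p \<nu> X Y j) (trunc_twist p \<alpha> Z k)) =
     (\<Oplus>\<^bsub>M\<^esub>b\<in>(case d of (i, s, c) \<Rightarrow> {(j, a, b). j + a + b = s}).
       ?g ((\<lambda>((i, s, c), (j, a, b)). (i, j, a, b, c)) (d, b)))"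
    using n d by (simp add: case_prod_beta' trunc_twist_def)
qed (use X Y Z n in \<open>auto simp: first.trunc_carrier term_closed finite_sum_tuples
    intro!: bij_betw_byWitness[where f' = "\<lambda>(i, j, a, b, c). ((i, j + a + b, c), (j, a, b))"]\<close>)

lemma jacobi_coeff_closed:
  assumes "n \<le> p" "x \<in> carrier M" "y \<in> carrier M" "z \<in> carrier M"
  shows "jacobi_coeff M \<alpha> \<mu> \<nu> n x y z \<in> carrier M"
  unfolding jacobi_coeff_def using assms
  by (intro first.M.finsum_closed)
    (auto intro!: first.jacobiator_closed first.op_bilinear second.op_bilinear first.twist)

text \<open>Each of the three summands of the expression is a sum over the degrees \<open>i, j\<close> of the two
  brackets and \<open>a, b, c\<close> of the three arguments; after the last two are renamed so that \<open>a, b, c\<close>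
  always belong to \<open>X, Y, Z\<close>, the three sums combine term by term. Grouping by \<open>m = i + j\<close>
  then exposes the coefficients at constant arguments.\<close>

lemma jacobiator_trunc:
  assumes X: "X \<in> carrier N" and Y: "Y \<in> carrier N" and Z: "Z \<in> carrier N" and n: "n \<le> p"
  shows "J X Y Z n = finsum M (\<lambda>(m, a, b, c). jacobi_coeff M \<alpha> \<mu> \<nu> m (X a) (Y b) (Z c))
      {(m, a, b, c). m + a + b + c = n}"
proof -
  let ?C = "{(i, j, a, b, c). i + j + a + b + c = n}"
  let ?t = "\<lambda>i j x y z. cochain_op (\<mu> i) (cochain_op (\<nu> j) x y) (\<alpha> z)"
  let ?j = "\<lambda>(i, j, a, b, c). jacobiator M \<alpha> (cochain_op (\<mu> i)) (cochain_op (\<nu> j)) (X a) (Y b) (Z c)"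
  have c: "?t i j (U a) (V b) (W c) \<in> carrier M"
    if "U \<in> carrier N" "V \<in> carrier N" "W \<in> carrier N" "i + j + a + b + c = n" for U V W i j a b c
    using that n by (intro term_closed) (auto simp: first.trunc_carrier)
  have 1: "finsum M (\<lambda>(i, j, a, b, c). ?t i j (Y a) (Z b) (X c)) ?C =
      finsum M (\<lambda>(i, j, a, b, c). ?t i j (Y b) (Z c) (X a)) ?C"
    by (rule first.M.finsum_bij[where h = "\<lambda>(i, j, b, c, a). (i, j, a, b, c)"])
      (use c[OF Y Z X] in \<open>auto simp: add_ac
        intro!: bij_betw_byWitness[where f' = "\<lambda>(i, j, a, b, c). (i, j, b, c, a)"]\<close>)
  have 2: "finsum M (\<lambda>(i, j, a, b, c). ?t i j (Z a) (X b) (Y c)) ?C =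
      finsum M (\<lambda>(i, j, a, b, c). ?t i j (Z c) (X a) (Y b)) ?C"
    by (rule first.M.finsum_bij[where h = "\<lambda>(i, j, c, a, b). (i, j, a, b, c)"])
      (use c[OF Z X Y] in \<open>auto simp: add_ac
        intro!: bij_betw_byWitness[where f' = "\<lambda>(i, j, a, b, c). (i, j, c, a, b)"]\<close>)
  have cYZX: "?t i j (Y b) (Z c) (X a) \<in> carrier M" if "i + j + a + b + c = n" for i j a b c
    using c[OF Y Z X, of i j b c a] that by (simp add: add_ac)
  have cZXY: "?t i j (Z c) (X a) (Y b) \<in> carrier M" if "i + j + a + b + c = n" for i j a b c
    using c[OF Z X Y, of i j c a b] that by (simp add: add_ac)
  have "J X Y Z n = finsum M (\<lambda>(i, j, a, b, c). ?t i j (X a) (Y b) (Z c)) ?C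
      \<oplus>\<^bsub>M\<^esub> finsum M (\<lambda>(i, j, a, b, c). ?t i j (Y b) (Z c) (X a)) ?C
      \<oplus>\<^bsub>M\<^esub> finsum M (\<lambda>(i, j, a, b, c). ?t i j (Z c) (X a) (Y b)) ?C"
    unfolding jacobiator_def first.trunc_apply[OF n]
    by (simp only: nested_bracket_apply[OF X Y Z n] nested_bracket_apply[OF Y Z X n]
        nested_bracket_apply[OF Z X Y n] 1 2)
  also have "\<dots> = finsum M ?j ?C"
  proof -
    have *: "finsum M ?j ?C = finsum M (\<lambda>d. case d of (i, j, a, b, c) \<Rightarrow>
        ?t i j (X a) (Y b) (Z c) \<oplus>\<^bsub>M\<^esub> ?t i j (Y b) (Z c) (X a)) ?C
      \<oplus>\<^bsub>M\<^esub> finsum M (\<lambda>(i, j, a, b, c). ?t i j (Z c) (X a) (Y b)) ?C"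
      by (rule first.M.finsum_split_add)
        (use c[OF X Y Z] cYZX cZXY in \<open>auto simp: jacobiator_def\<close>)
    also have "finsum M (\<lambda>d. case d of (i, j, a, b, c) \<Rightarrow>
        ?t i j (X a) (Y b) (Z c) \<oplus>\<^bsub>M\<^esub> ?t i j (Y b) (Z c) (X a)) ?C =
        finsum M (\<lambda>(i, j, a, b, c). ?t i j (X a) (Y b) (Z c)) ?C
      \<oplus>\<^bsub>M\<^esub> finsum M (\<lambda>(i, j, a, b, c). ?t i j (Y b) (Z c) (X a)) ?C"
      by (rule first.M.finsum_split_add)
        (use c[OF X Y Z] cYZX in auto)
    finally show ?thesis by (rule sym)
  qed
  also have "\<dots> = finsum M (\<lambda>(m, a, b, c). jacobi_coeff M \<alpha> \<mu> \<nu> m (X a) (Y b) (Z c))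
      {(m, a, b, c). m + a + b + c = n}"
  proof (rule sym, rule first.M.finsum_nested_reindex[where B = "\<lambda>(m, a, b, c). {..m}"
        and h = "\<lambda>((m, a, b, c), i). (i, m - i, a, b, c)"])
    show "?j d \<in> carrier M" if "d \<in> ?C" for d
    proof -
      obtain i j a b c where d: "d = (i, j, a, b, c)" "i + j + a + b + c = n"
        using \<open>d \<in> ?C\<close> by auto
      then show ?thesis using X Y Z n
        by (auto simp: first.trunc_carrier
            intro!: first.jacobiator_closed first.op_bilinear second.op_bilinear first.twist)
    qed
  qed (auto simp: finite_sum_tuples jacobi_coeff_def
      intro!: bij_betw_byWitness[where f' = "\<lambda>(i, j, a, b, c). ((i + j, a, b, c), i)"])
  finally show ?thesis .
qed

end

definition trunc_const :: "('k, 'v, 'b) module_scheme \<Rightarrow> nat \<Rightarrow> 'v \<Rightarrow> nat \<Rightarrow> 'v" where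
  "trunc_const M p x = (\<lambda>n\<in>{..p}. if n = 0 then x else \<zero>\<^bsub>M\<^esub>)"

lemma (in module) trunc_const_closed:
  "x \<in> carrier M \<Longrightarrow> trunc_const M p x \<in> carrier (trunc_module M p)"
  by (auto simp: trunc_const_def trunc_carrier)

lemma (in cochain_family_pair) jacobi_coeff_zero:
  assumes n: "n \<le> p" and x: "x \<in> carrier M" and y: "y \<in> carrier M" and z: "z \<in> carrier M"
    and "x = \<zero>\<^bsub>M\<^esub> \<or> y = \<zero>\<^bsub>M\<^esub> \<or> z = \<zero>\<^bsub>M\<^esub>"
  shows "jacobi_coeff M \<alpha> \<mu> \<nu> n x y z = \<zero>\<^bsub>M\<^esub>"
  unfolding jacobi_coeff_def
proof (rule first.M.add.finprod_one_eqI)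
  fix i assume "i \<in> {..n}"
  then have i: "i \<le> p" "n - i \<le> p" using n by auto
  note closed = first.module_endoD(1)[OF first.twist] second.op_simps(1)[OF i(2)]
  note zero = first.module_endo_zero[OF first.twist] first.op_simps(6,7)[OF i(1)]
    second.op_simps(6,7)[OF i(2)]
  consider "x = \<zero>\<^bsub>M\<^esub>" | "y = \<zero>\<^bsub>M\<^esub>" | "z = \<zero>\<^bsub>M\<^esub>" using assms(5) by blast
  then show "jacobiator M \<alpha> (cochain_op (\<mu> i)) (cochain_op (\<nu> (n - i))) x y z = \<zero>\<^bsub>M\<^esub>"
    by cases (use x y z in \<open>simp_all add: jacobiator_def closed zero\<close>)
qed

text \<open>For constant power series only the summand with \<open>a = b = c = 0\<close> survives, so the
  coefficients \<open>jacobi_coeff\<close> can be recovered from the truncated algebra. With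
  \<open>jacobiator_trunc\<close> this makes their vanishing equivalent to the identity for all power series.\<close>

lemma (in cochain_family_pair) jacobiator_trunc_const:
  assumes x: "x \<in> carrier M" and y: "y \<in> carrier M" and z: "z \<in> carrier M" and n: "n \<le> p"
  shows "J (trunc_const M p x) (trunc_const M p y) (trunc_const M p z) n = jacobi_coeff M \<alpha> \<mu> \<nu> n x y z"
proof -
  let ?c = "trunc_const M p" and ?C = "{(m, a, b, c). m + a + b + c = n}"
  let ?g = "\<lambda>(m, a, b, c). jacobi_coeff M \<alpha> \<mu> \<nu> m (?c x a) (?c y b) (?c z c)"
  have c: "?c u i \<in> carrier M" if "u \<in> carrier M" "i \<le> p" for u i
    using that by (auto simp: trunc_const_def)
  have 0: "?c u i = \<zero>\<^bsub>M\<^esub>" if "0 < i" "i \<le> p" for u i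
    using that by (auto simp: trunc_const_def)
  have g_closed: "?g d \<in> carrier M" if d: "d \<in> ?C" for d
  proof -
    obtain m i j k where d: "d = (m, i, j, k)" "m + i + j + k = n" using d by auto
    then have "m \<le> p" "i \<le> p" "j \<le> p" "k \<le> p" using n by auto
    with d show ?thesis using x y z by (simp add: c jacobi_coeff_closed)
  qed
  have "finsum M ?g ?C = ?g (n, 0, 0, 0)"
  proof (rule first.M.finsum_single)
    fix d assume d: "d \<in> ?C" "d \<noteq> (n, 0, 0, 0)"
    then obtain m i j k where ijk: "d = (m, i, j, k)" "m + i + j + k = n" by auto
    with d(2) have pos: "0 < i \<or> 0 < j \<or> 0 < k" by auto
    have le: "m \<le> p" "i \<le> p" "j \<le> p" "k \<le> p" using ijk(2) n by auto
    have "?c x i = \<zero>\<^bsub>M\<^esub> \<or> ?c y j = \<zero>\<^bsub>M\<^esub> \<or> ?c z k = \<zero>\<^bsub>M\<^esub>"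
      using pos 0[OF _ le(2)] 0[OF _ le(3)] 0[OF _ le(4)] by blast
    then have "jacobi_coeff M \<alpha> \<mu> \<nu> m (?c x i) (?c y j) (?c z k) = \<zero>\<^bsub>M\<^esub>"
      by (intro jacobi_coeff_zero le c x y z)
    then show "?g d = \<zero>\<^bsub>M\<^esub>" by (simp add: ijk(1))
  next
    show "finite ?C" by (rule finite_sum_tuples)
    show "(n, 0, 0, 0) \<in> ?C" by simp
    then show "?g (n, 0, 0, 0) \<in> carrier M" by (rule g_closed)
  qed
  moreover have "?c u 0 = u" for u by (simp add: trunc_const_def)
  ultimately show ?thesis
    using jacobiator_trunc[OF first.trunc_const_closed[OF x] first.trunc_const_closed[OF y]
        first.trunc_const_closed[OF z] n] by simp
qed

lemma (in cochain_family) hom_lie_trunc_iff: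
  "hom_lie_algebra T N br (trunc_twist p \<alpha>) \<longleftrightarrow>
    (\<forall>n\<le>p. \<forall>x\<in>carrier M. \<forall>y\<in>carrier M. \<forall>z\<in>carrier M. jacobi_coeff M \<alpha> \<mu> \<mu> n x y z = \<zero>\<^bsub>M\<^esub>)"
    (is "?L \<longleftrightarrow> ?R")
proof -
  interpret P: cochain_family_pair R M \<alpha> p \<mu> \<mu> ..
  interpret T: module T N by (rule trunc_module_module)
  have "?L \<longleftrightarrow> (\<forall>X\<in>carrier N. \<forall>Y\<in>carrier N. \<forall>Z\<in>carrier N. P.J X Y Z = \<zero>\<^bsub>N\<^esub>)"
    unfolding T.hom_lie_algebra_iff
    using trunc_twist_endo[OF twist] trunc_bracket_bilinear trunc_bracket_skew
      trunc_bracket_multiplicative by blast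
  also have "\<dots> \<longleftrightarrow> ?R"
  proof (intro iffI allI impI ballI)
    fix n x y z assume *: "n \<le> p" "x \<in> carrier M" "y \<in> carrier M" "z \<in> carrier M"
      and "\<forall>X\<in>carrier N. \<forall>Y\<in>carrier N. \<forall>Z\<in>carrier N. P.J X Y Z = \<zero>\<^bsub>N\<^esub>"
    then have "P.J (trunc_const M p x) (trunc_const M p y) (trunc_const M p z) n = \<zero>\<^bsub>N\<^esub> n"
      using trunc_const_closed by simp
    then show "jacobi_coeff M \<alpha> \<mu> \<mu> n x y z = \<zero>\<^bsub>M\<^esub>"
      using * by (simp add: P.jacobiator_trunc_const trunc_apply)
  next
    fix X Y Z assume R: ?R and XYZ: "X \<in> carrier N" "Y \<in> carrier N" "Z \<in> carrier N"
    show "P.J X Y Z = \<zero>\<^bsub>N\<^esub>"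
    proof (rule trunc_module_eqI[where p = p])
      fix n assume n: "n \<le> p"
      show "P.J X Y Z n = \<zero>\<^bsub>N\<^esub> n"
        unfolding P.jacobiator_trunc[OF XYZ n] trunc_apply[OF n]
        by (rule M.add.finprod_one_eqI) (use R XYZ n in \<open>auto simp: trunc_carrier\<close>)
    qed (use XYZ in \<open>auto intro!: T.jacobiator_closed trunc_bracket_bilinear trunc_twist_endo twist\<close>)
  qed
  finally show ?thesis .
qed

lemma (in cochain_family_pair) mixed_jacobi_trunc_iff:
  "(\<forall>X\<in>carrier N. \<forall>Y\<in>carrier N. \<forall>Z\<in>carrier N.
      jacobiator N (trunc_twist p \<alpha>) first.br second.br X Y Z \<oplus>\<^bsub>N\<^esub>
      jacobiator N (trunc_twist p \<alpha>) second.br first.br X Y Z = \<zero>\<^bsub>N\<^esub>) \<longleftrightarrow>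
   (\<forall>n\<le>p. \<forall>x\<in>carrier M. \<forall>y\<in>carrier M. \<forall>z\<in>carrier M.
      jacobi_coeff M \<alpha> \<mu> \<nu> n x y z \<oplus>\<^bsub>M\<^esub> jacobi_coeff M \<alpha> \<nu> \<mu> n x y z = \<zero>\<^bsub>M\<^esub>)"
    (is "?L \<longleftrightarrow> ?R")
proof -
  interpret S: cochain_family_pair R M \<alpha> p \<nu> \<mu> ..
  interpret T: module first.T N by (rule first.trunc_module_module)
  show ?thesis
  proof (intro iffI allI impI ballI)
    fix n x y z assume *: "n \<le> p" "x \<in> carrier M" "y \<in> carrier M" "z \<in> carrier M" and ?L
    then have "(J (trunc_const M p x) (trunc_const M p y) (trunc_const M p z) \<oplus>\<^bsub>N\<^esub>
        S.J (trunc_const M p x) (trunc_const M p y) (trunc_const M p z)) n = \<zero>\<^bsub>N\<^esub> n"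
      using first.trunc_const_closed by simp
    then show "jacobi_coeff M \<alpha> \<mu> \<nu> n x y z \<oplus>\<^bsub>M\<^esub> jacobi_coeff M \<alpha> \<nu> \<mu> n x y z = \<zero>\<^bsub>M\<^esub>"
      using * by (simp add: jacobiator_trunc_const S.jacobiator_trunc_const first.trunc_apply)
  next
    fix X Y Z assume R: ?R and XYZ: "X \<in> carrier N" "Y \<in> carrier N" "Z \<in> carrier N"
    show "J X Y Z \<oplus>\<^bsub>N\<^esub> S.J X Y Z = \<zero>\<^bsub>N\<^esub>"
    proof (rule first.trunc_module_eqI[where p = p])
      fix n assume n: "n \<le> p"
      let ?C = "{(m, a, b, c). m + a + b + c = n}"
      have "\<zero>\<^bsub>M\<^esub> = (\<Oplus>\<^bsub>M\<^esub>d\<in>?C. \<zero>\<^bsub>M\<^esub>)" by simp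
      also have "\<dots> = J X Y Z n \<oplus>\<^bsub>M\<^esub> S.J X Y Z n"
        unfolding jacobiator_trunc[OF XYZ n] S.jacobiator_trunc[OF XYZ n]
        by (rule first.M.finsum_split_add)
          (use R XYZ n in \<open>auto simp: first.trunc_carrier jacobi_coeff_closed S.jacobi_coeff_closed\<close>)
      finally show "(J X Y Z \<oplus>\<^bsub>N\<^esub> S.J X Y Z) n = \<zero>\<^bsub>N\<^esub> n"
        by (simp add: first.trunc_apply[OF n])
    qed (use XYZ in \<open>auto intro!: T.M.a_closed T.jacobiator_closed first.trunc_bracket_bilinear
        second.trunc_bracket_bilinear first.trunc_twist_endo first.twist\<close>)
  qed
qed

text \<open>The mixed Jacobi identity is applied over the truncated power series ring, where it is
  again a family of conditions on coefficients.\<close>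

lemma (in cochain_family_pair) compatible_trunc_iff:
  "compatible_hom_lie_algebra first.T N first.br second.br (trunc_twist p \<alpha>) \<longleftrightarrow>
   (\<forall>n\<le>p. \<forall>x\<in>carrier M. \<forall>y\<in>carrier M. \<forall>z\<in>carrier M.
      jacobi_coeff M \<alpha> \<mu> \<mu> n x y z = \<zero>\<^bsub>M\<^esub> \<and>
      jacobi_coeff M \<alpha> \<mu> \<nu> n x y z \<oplus>\<^bsub>M\<^esub> jacobi_coeff M \<alpha> \<nu> \<mu> n x y z = \<zero>\<^bsub>M\<^esub> \<and>
      jacobi_coeff M \<alpha> \<nu> \<nu> n x y z = \<zero>\<^bsub>M\<^esub>)"
proof -
  interpret T: module first.T N by (rule first.trunc_module_module)
  have "compatible_hom_lie_algebra first.T N first.br second.br (trunc_twist p \<alpha>) \<longleftrightarrow>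
    hom_lie_algebra first.T N first.br (trunc_twist p \<alpha>) \<and>
    hom_lie_algebra first.T N second.br (trunc_twist p \<alpha>) \<and>
    (\<forall>X\<in>carrier N. \<forall>Y\<in>carrier N. \<forall>Z\<in>carrier N.
      jacobiator N (trunc_twist p \<alpha>) first.br second.br X Y Z \<oplus>\<^bsub>N\<^esub>
      jacobiator N (trunc_twist p \<alpha>) second.br first.br X Y Z = \<zero>\<^bsub>N\<^esub>)"
    using T.compatible_iff_mixed_jacobi unfolding compatible_hom_lie_algebra_def by blast
  then show ?thesis
    unfolding first.hom_lie_trunc_iff second.hom_lie_trunc_iff mixed_jacobi_trunc_iff by blast
qed

section \<open>Cochains of degree two and three\<close>

lemma (in abelian_group) add_pow_sign:
  assumes "x \<in> carrier G"
  shows "[(1::int)] \<cdot>\<^bsub>G\<^esub> x = x" and "[(- 1::int)] \<cdot>\<^bsub>G\<^esub> x = \<ominus> x"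
  using assms a_group by (simp_all add: add_pow_def group.int_pow_neg group.int_pow_1 a_inv_def)

text \<open>A \<open>(2, 1)\<close>-shuffle is determined by the value of its last argument. The third permutation is the
  cycle \<open>0 \<mapsto> 1 \<mapsto> 2 \<mapsto> 0\<close>, written as a product of transpositions to expose its sign.\<close>

lemma shuffle_perms_2_1:
  "shuffle_perms 2 1 = {id, transpose 1 2, transpose 0 1 \<circ> transpose 1 2}"
proof (intro equalityI subsetI)
  fix \<sigma> assume "\<sigma> \<in> shuffle_perms 2 1"
  then have perm: "\<sigma> permutes {..<3}" and mono: "strict_mono_on {..<2} \<sigma>"
    by (simp_all add: shuffle_perms_def)
  have less: "\<sigma> 0 < \<sigma> 1" by (rule strict_mono_onD[OF mono]) simp_all
  have inj: "\<sigma> 0 \<noteq> \<sigma> 2" "\<sigma> 1 \<noteq> \<sigma> 2"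
    using inj_eq[OF permutes_inj[OF perm]] by simp_all
  have bound: "\<sigma> i < 3" if "i < 3" for i
    using permutes_in_image[OF perm, of i] that by simp
  have fix_ge: "\<sigma> n = n" if "3 \<le> n" for n
    using permutes_not_in[OF perm] that by simp
  have cases: "(\<sigma> 0 = 0 \<and> \<sigma> 1 = 1 \<and> \<sigma> 2 = 2) \<or> (\<sigma> 0 = 0 \<and> \<sigma> 1 = 2 \<and> \<sigma> 2 = 1) \<or>
      (\<sigma> 0 = 1 \<and> \<sigma> 1 = 2 \<and> \<sigma> 2 = 0)"
    using less inj bound[of 0] bound[of 1] bound[of 2] by simp linarith
  have eqI: "\<sigma> = \<tau>" if "\<sigma> 0 = \<tau> 0" "\<sigma> 1 = \<tau> 1" "\<sigma> 2 = \<tau> 2" "\<And>n. 3 \<le> n \<Longrightarrow> \<tau> n = n" for \<tau>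
  proof
    fix n :: nat
    consider "n = 0" | "n = 1" | "n = 2" | "3 \<le> n" by linarith
    then show "\<sigma> n = \<tau> n" by cases (simp_all only: that fix_ge)
  qed
  show "\<sigma> \<in> {id, transpose 1 2, transpose 0 1 \<circ> transpose 1 2}"
    using cases
  proof (elim disjE conjE)
    assume "\<sigma> 0 = 0" "\<sigma> 1 = 1" "\<sigma> 2 = 2"
    then have "\<sigma> = id" by (intro eqI) simp_all
    then show ?thesis by simp
  next
    assume "\<sigma> 0 = 0" "\<sigma> 1 = 2" "\<sigma> 2 = 1"
    then have "\<sigma> = transpose 1 2" by (intro eqI) (simp_all add: transpose_def)
    then show ?thesis by simp
  next
    assume "\<sigma> 0 = 1" "\<sigma> 1 = 2" "\<sigma> 2 = 0"
    then have "\<sigma> = transpose 0 1 \<circ> transpose 1 2" by (intro eqI) (simp_all add: transpose_def)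
    then show ?thesis by simp
  qed
next
  have mono2: "strict_mono_on {..<2} \<tau> \<longleftrightarrow> \<tau> 0 < \<tau> 1" and mono1: "strict_mono_on {2..<2 + 1} \<tau>"
    for \<tau> :: "nat \<Rightarrow> nat"
    by (auto simp: strict_mono_on_def less_2_cases_iff)
  fix \<sigma> :: "nat \<Rightarrow> nat" assume \<sigma>: "\<sigma> \<in> {id, transpose 1 2, transpose 0 1 \<circ> transpose 1 2}"
  have "transpose 1 2 permutes {..<2 + 1::nat}" "transpose 0 1 permutes {..<2 + 1::nat}"
    by (rule permutes_swap_id; simp)+
  moreover from this have "transpose 0 1 \<circ> transpose 1 2 permutes {..<2 + 1::nat}"
    by (intro permutes_compose)
  ultimately have "\<sigma> permutes {..<2 + 1}"
    using \<sigma> permutes_id by blast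
  moreover have "\<sigma> 0 < \<sigma> 1"
    using \<sigma> by (elim insertE emptyE; simp add: transpose_def)
  ultimately show "\<sigma> \<in> shuffle_perms 2 1"
    unfolding shuffle_perms_def mem_Collect_eq mono2 using mono1 by blast
qed

lemma (in module) args3:
  "xs \<in> args M 3 \<longleftrightarrow> (\<exists>x\<in>carrier M. \<exists>y\<in>carrier M. \<exists>z\<in>carrier M. xs = [x, y, z])"
  by (auto simp: args_def numeral_3_eq_3 length_Suc_conv)

text \<open>The three shuffles give \<open>P(Q(x, y), \<alpha> z) - P(Q(x, z), \<alpha> y) + P(Q(y, z), \<alpha> x)\<close>, and skewness
  of \<open>Q\<close> turns the middle term into \<open>P(Q(z, x), \<alpha> y)\<close>.\<close>

lemma (in module) nr_comp_eq_jacobiator: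
  assumes \<alpha>: "module_endo R M \<alpha>"
    and P: "P \<in> hom_cochains R M \<alpha> 2" and Q: "Q \<in> hom_cochains R M \<alpha> 2"
    and xyz: "x \<in> carrier M" "y \<in> carrier M" "z \<in> carrier M"
  shows "nr_comp M \<alpha> 1 1 P Q [x, y, z] = jacobiator M \<alpha> (cochain_op P) (cochain_op Q) x y z"
proof -
  let ?t = "transpose 1 2 :: nat \<Rightarrow> nat" and ?c = "transpose 0 1 \<circ> transpose 1 2 :: nat \<Rightarrow> nat"
  let ?f = "\<lambda>\<sigma>. [sign \<sigma>] \<cdot>\<^bsub>M\<^esub> P (Q (map (\<lambda>i. [x, y, z] ! \<sigma> i) [0..<1 + 1]) #
          map (\<lambda>i. (\<alpha> ^^ 1) ([x, y, z] ! \<sigma> i)) [1 + 1..<1 + 1 + 1])"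
  note p = bilinear_op_simps[OF cochain_op_bilinear[OF P]]
  note q = bilinear_op_simps[OF cochain_op_bilinear[OF Q]]
  note a = module_endoD(1)[OF \<alpha>]
  have sign: "sign id = 1" "sign ?t = - 1" "sign ?c = 1"
    by (simp_all add: sign_swap_id sign_compose permutation_swap_id)
  have upt: "[0..<1 + 1] = [0, 1]" "[1 + 1..<1 + 1 + 1] = [2]"
    by (simp_all add: upt_conv_Cons)
  have f1: "?f id = cochain_op P (cochain_op Q x y) (\<alpha> z)"
    using xyz unfolding upt sign by (simp add: cochain_op_def[symmetric] M.add_pow_sign p q a)
  have f2: "?f ?t = cochain_op P (cochain_op Q z x) (\<alpha> y)"
  proof -
    have "?f ?t = \<ominus>\<^bsub>M\<^esub> cochain_op P (cochain_op Q x z) (\<alpha> y)"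
      using xyz unfolding upt sign
      by (simp add: cochain_op_def[symmetric] M.add_pow_sign p q a transpose_def)
    also have "\<dots> = \<ominus>\<^bsub>M\<^esub> cochain_op P (\<ominus>\<^bsub>M\<^esub> cochain_op Q z x) (\<alpha> y)"
      using xyz cochain_op_skew[OF Q, of x z] by simp
    also have "\<dots> = cochain_op P (cochain_op Q z x) (\<alpha> y)"
    proof -
      have "cochain_op P (\<ominus>\<^bsub>M\<^esub> u) v = \<ominus>\<^bsub>M\<^esub> cochain_op P u v"
        if uv: "u \<in> carrier M" "v \<in> carrier M" for u v
        using uv p(2)[of "\<ominus>\<^bsub>M\<^esub> u" u v] p(6)[of v] p(1) M.minus_equality
        by (metis M.a_inv_closed M.l_neg)
      then show ?thesis using xyz by (simp add: p q a)
    qed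
    finally show ?thesis .
  qed
  have f3: "?f ?c = cochain_op P (cochain_op Q y z) (\<alpha> x)"
    using xyz unfolding upt sign
    by (simp add: cochain_op_def[symmetric] M.add_pow_sign p q a transpose_def)
  have at_points: "?t 0 = 0" "?t 1 = 2" "?c 0 = 1"
    by (simp_all add: transpose_def)
  have distinct: "id \<noteq> ?t" "id \<noteq> ?c" "?t \<noteq> ?c"
  proof -
    show "id \<noteq> ?t"
    proof
      assume "id = ?t"
      from fun_cong[OF this, of 1] show False unfolding at_points by simp
    qed
    show "id \<noteq> ?c"
    proof
      assume "id = ?c"
      from fun_cong[OF this, of 0] show False unfolding at_points by simp
    qed
    show "?t \<noteq> ?c"
    proof
      assume "?t = ?c"
      from fun_cong[OF this, of 0] show False unfolding at_points by simp
    qed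
  qed
  define F where "F = ?f"
  have F: "F id = cochain_op P (cochain_op Q x y) (\<alpha> z)" "F ?t = cochain_op P (cochain_op Q z x) (\<alpha> y)"
    "F ?c = cochain_op P (cochain_op Q y z) (\<alpha> x)"
    unfolding F_def by (rule f1 f2 f3)+
  have closed: "F id \<in> carrier M" "F ?t \<in> carrier M" "F ?c \<in> carrier M"
    unfolding F using xyz by (simp_all add: p(1) q(1) a)
  have "[x, y, z] \<in> args M (1 + 1 + 1)" using xyz by (auto simp: args_def)
  then have "nr_comp M \<alpha> 1 1 P Q [x, y, z] = (\<Oplus>\<^bsub>M\<^esub>\<sigma>\<in>shuffle_perms (1 + 1) 1. F \<sigma>)"
    unfolding nr_comp_def F_def by (simp only: restrict_apply')
  also have "shuffle_perms (1 + 1) 1 = {id, ?t, ?c}"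
    by (simp only: one_add_one shuffle_perms_2_1)
  also have "(\<Oplus>\<^bsub>M\<^esub>\<sigma>\<in>{id, ?t, ?c}. F \<sigma>) = F id \<oplus>\<^bsub>M\<^esub> (F ?t \<oplus>\<^bsub>M\<^esub> F ?c)"
    using distinct closed by (simp add: Pi_def del: One_nat_def)
  also have "\<dots> = jacobiator M \<alpha> (cochain_op P) (cochain_op Q) x y z"
    unfolding F jacobiator_def using xyz by (simp add: p(1) q(1) a M.a_ac)
  finally show ?thesis .
qed

text \<open>The sign in the bracket is \<open>-(-1) = 1\<close> in this degree, so it is symmetric.\<close>

lemma (in module) nr_bracket_eq_jacobiators:
  assumes \<alpha>: "module_endo R M \<alpha>"
    and P: "P \<in> hom_cochains R M \<alpha> 2" and Q: "Q \<in> hom_cochains R M \<alpha> 2"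
    and xyz: "x \<in> carrier M" "y \<in> carrier M" "z \<in> carrier M"
  shows "nr_bracket M \<alpha> 1 1 P Q [x, y, z] =
    jacobiator M \<alpha> (cochain_op P) (cochain_op Q) x y z \<oplus>\<^bsub>M\<^esub>
    jacobiator M \<alpha> (cochain_op Q) (cochain_op P) x y z"
proof -
  note closed = jacobiator_closed[OF cochain_op_bilinear cochain_op_bilinear \<alpha> xyz]
  have "[x, y, z] \<in> args M (1 + 1 + 1)" using xyz by (auto simp: args_def)
  then have "nr_bracket M \<alpha> 1 1 P Q [x, y, z] = nr_comp M \<alpha> 1 1 P Q [x, y, z] \<ominus>\<^bsub>M\<^esub>
      [((- 1 :: int) ^ (1 * 1))] \<cdot>\<^bsub>M\<^esub> nr_comp M \<alpha> 1 1 Q P [x, y, z]"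
    by (simp only: nr_bracket_def restrict_apply')
  then show ?thesis
    using closed[OF P Q] closed[OF Q P]
    by (simp add: nr_comp_eq_jacobiator[OF \<alpha> P Q xyz] nr_comp_eq_jacobiator[OF \<alpha> Q P xyz]
        M.add_pow_sign M.minus_eq del: One_nat_def)
qed

text \<open>The degree-two case of \<open>\<delta> f = (-1)\<^sup>n\<^sup>-\<^sup>1 [\<mu>, f]\<close>: the first sum of the coboundary contributes
  \<open>- J(\<mu>, f)\<close> and the second \<open>- J(f, \<mu>)\<close>, after skewness has put the arguments in cyclic order.\<close>

lemma (in module) hom_delta_eq_jacobiators:
  assumes \<alpha>: "module_endo R M \<alpha>"
    and br: "bracket_cochain M br \<in> hom_cochains R M \<alpha> 2" and f: "f \<in> hom_cochains R M \<alpha> 2"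
    and xyz: "x \<in> carrier M" "y \<in> carrier M" "z \<in> carrier M"
  shows "hom_delta M br \<alpha> 2 f [x, y, z] = \<ominus>\<^bsub>M\<^esub>
    (jacobiator M \<alpha> (cochain_op (bracket_cochain M br)) (cochain_op f) x y z \<oplus>\<^bsub>M\<^esub>
     jacobiator M \<alpha> (cochain_op f) (cochain_op (bracket_cochain M br)) x y z)"
proof -
  let ?b = "cochain_op (bracket_cochain M br)" and ?f = "cochain_op f"
  note b = bilinear_op_simps(1)[OF cochain_op_bilinear[OF br]]
  note ff = bilinear_op_simps[OF cochain_op_bilinear[OF f]]
  note a = module_endoD(1)[OF \<alpha>]
  have br_eq: "br u v = ?b u v" if "u \<in> carrier M" "v \<in> carrier M" for u v
    using that by (simp add: cochain_op_def bracket_cochain_def args2)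
  have neg: "?f (\<ominus>\<^bsub>M\<^esub> u) v = \<ominus>\<^bsub>M\<^esub> ?f u v" "?b v (\<ominus>\<^bsub>M\<^esub> u) = \<ominus>\<^bsub>M\<^esub> ?b v u"
    if uv: "u \<in> carrier M" "v \<in> carrier M" for u v
    using uv ff(2)[of "\<ominus>\<^bsub>M\<^esub> u" u v] ff(6)[of v] ff(1) M.minus_equality
      bilinear_op_simps(3,7)[OF cochain_op_bilinear[OF br]] b
    by (metis M.a_inv_closed M.l_neg)+
  have sets: "{..2} = {0, 1, 2::nat}" "{..<0} = ({}::nat set)" "{..<1} = {0::nat}" "{..<2} = {0, 1::nat}"
    by auto
  have nths1: "nths [x, y, z] (- {0}) = [y, z]" "nths [x, y, z] (- {1}) = [x, z]"
    "nths [x, y, z] (- {2}) = [x, y]"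
    "nths [x, y, z] (- {0, 1}) = [z]" "nths [x, y, z] (- {0, 2}) = [y]" "nths [x, y, z] (- {1, 2}) = [x]"
    by (simp_all add: nths_Cons)
  have fold: "f [u, v] = ?f u v" for u v by (simp add: cochain_op_def)
  have "[x, y, z] \<in> args M (2 + 1)" using xyz by (auto simp: args_def)
  then have "hom_delta M br \<alpha> 2 f [x, y, z] =
     (\<Oplus>\<^bsub>M\<^esub>k\<in>{0, 1, 2}. [((-1 :: int) ^ k)] \<cdot>\<^bsub>M\<^esub>
        br ((\<alpha> ^^ (2 - 1)) ([x, y, z] ! k)) (f (nths [x, y, z] (- {k})))) \<oplus>\<^bsub>M\<^esub>
     (\<Oplus>\<^bsub>M\<^esub>l\<in>{0, 1, 2}. \<Oplus>\<^bsub>M\<^esub>k\<in>{..<l}. [((-1 :: int) ^ (k + l))] \<cdot>\<^bsub>M\<^esub>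
        f (br ([x, y, z] ! k) ([x, y, z] ! l) # map \<alpha> (nths [x, y, z] (- {k, l}))))"
    by (simp only: hom_delta_def restrict_apply' sets(1))
  also have "(\<Oplus>\<^bsub>M\<^esub>k\<in>{0, 1, 2}. [((-1 :: int) ^ k)] \<cdot>\<^bsub>M\<^esub>
        br ((\<alpha> ^^ (2 - 1)) ([x, y, z] ! k)) (f (nths [x, y, z] (- {k})))) =
      ?b (\<alpha> x) (?f y z) \<oplus>\<^bsub>M\<^esub> (\<ominus>\<^bsub>M\<^esub> ?b (\<alpha> y) (?f x z) \<oplus>\<^bsub>M\<^esub> ?b (\<alpha> z) (?f x y))"
    using xyz by (simp add: nths1[simplified] fold br_eq a ff b M.add_pow_sign Pi_def)
  also have "(\<Oplus>\<^bsub>M\<^esub>l\<in>{0, 1, 2}. \<Oplus>\<^bsub>M\<^esub>k\<in>{..<l}. [((-1 :: int) ^ (k + l))] \<cdot>\<^bsub>M\<^esub>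
        f (br ([x, y, z] ! k) ([x, y, z] ! l) # map \<alpha> (nths [x, y, z] (- {k, l})))) =
      \<ominus>\<^bsub>M\<^esub> ?f (?b x y) (\<alpha> z) \<oplus>\<^bsub>M\<^esub> (?f (?b x z) (\<alpha> y) \<oplus>\<^bsub>M\<^esub> \<ominus>\<^bsub>M\<^esub> ?f (?b y z) (\<alpha> x))"
    using xyz by (simp add: nths1[simplified] sets[simplified] fold br_eq a ff b M.add_pow_sign Pi_def)
  also have "?b (\<alpha> x) (?f y z) = \<ominus>\<^bsub>M\<^esub> ?b (?f y z) (\<alpha> x)"
    using xyz by (intro cochain_op_skew[OF br] a ff)
  also have "?b (\<alpha> z) (?f x y) = \<ominus>\<^bsub>M\<^esub> ?b (?f x y) (\<alpha> z)"
    using xyz by (intro cochain_op_skew[OF br] a ff)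
  also have "\<ominus>\<^bsub>M\<^esub> ?b (\<alpha> y) (?f x z) = \<ominus>\<^bsub>M\<^esub> ?b (?f z x) (\<alpha> y)"
  proof -
    have "?b (\<alpha> y) (?f x z) = \<ominus>\<^bsub>M\<^esub> ?b (\<alpha> y) (?f z x)"
      using xyz by (subst cochain_op_skew[OF f, of x z]) (simp_all add: neg a ff)
    also have "\<dots> = ?b (?f z x) (\<alpha> y)"
      using xyz by (intro cochain_op_skew[OF br, symmetric] a ff)
    finally show ?thesis by simp
  qed
  also have "?f (?b x z) (\<alpha> y) = \<ominus>\<^bsub>M\<^esub> ?f (?b z x) (\<alpha> y)"
    using xyz by (subst cochain_op_skew[OF br, of x z]) (simp_all add: neg a b)
  finally show ?thesis
    using xyz by (simp add: jacobiator_def a b ff M.minus_add M.a_ac)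
qed

section \<open>Coboundaries form a subgroup\<close>

text \<open>All functions on argument lists with values in the module, under pointwise addition. Cochains of a
  given degree form a subgroup of this group, and coboundaries can be compared with other functions
  here before anything is known about alternation or multiplicativity of a coboundary.\<close>

abbreviation value_group :: "('k, 'v, 'b) module_scheme \<Rightarrow> nat \<Rightarrow> ('v list \<Rightarrow> 'v) monoid" where
  "value_group M n \<equiv> product_group (args M n) (\<lambda>_. add_monoid M)"

context module
begin

lemma module_endo_cong:
  assumes "\<And>x. x \<in> carrier M \<Longrightarrow> f x = g x" and "module_endo R M g"
  shows "module_endo R M f"
  using assms unfolding module_endo_def by (auto simp: Pi_def)

lemma module_endo_add:
  assumes f: "module_endo R M f" and g: "module_endo R M g"
  shows "module_endo R M (\<lambda>x. f x \<oplus>\<^bsub>M\<^esub> g x)"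
  unfolding module_endo_def
  by (auto simp: module_endoD[OF f] module_endoD[OF g] smult_r_distr M.a_ac)

lemma module_endo_neg:
  assumes f: "module_endo R M f"
  shows "module_endo R M (\<lambda>x. \<ominus>\<^bsub>M\<^esub> f x)"
  unfolding module_endo_def
  by (auto simp: module_endoD[OF f] smult_r_minus M.minus_add)

lemma module_endo_minus:
  assumes f: "module_endo R M f" and x: "x \<in> carrier M"
  shows "f (\<ominus>\<^bsub>M\<^esub> x) = \<ominus>\<^bsub>M\<^esub> f x"
proof -
  have "f (\<ominus>\<^bsub>M\<^esub> x) \<oplus>\<^bsub>M\<^esub> f x = f (\<ominus>\<^bsub>M\<^esub> x \<oplus>\<^bsub>M\<^esub> x)"
    using x by (simp add: module_endoD(2)[OF f])
  also have "\<dots> = \<zero>\<^bsub>M\<^esub>"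
    using x by (simp add: M.l_neg module_endo_zero[OF f])
  finally show ?thesis
    using x by (metis M.minus_equality M.a_inv_closed module_endoD(1)[OF f])
qed

lemma args_update: "\<lbrakk>xs \<in> args M n; y \<in> carrier M\<rbrakk> \<Longrightarrow> xs[i := y] \<in> args M n"
  using set_update_subset_insert[of xs i y] by (auto simp: args_def)

lemma args_map: "\<lbrakk>xs \<in> args M n; module_endo R M \<alpha>\<rbrakk> \<Longrightarrow> map \<alpha> xs \<in> args M n"
  by (auto simp: args_def module_endoD)

lemma value_group_group: "group (value_group M n)"
  by (rule product_group) (rule M.a_group)

text \<open>Each of the three conditions on a cochain is preserved by pointwise sums and negatives; \<open>I\<close>
  below is the membership criterion shared by zero, negatives and sums.\<close>

lemma hom_cochains_subgroup:
  assumes \<alpha>: "module_endo R M \<alpha>"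
  shows "subgroup (hom_cochains R M \<alpha> n) (value_group M n)"
proof (rule group.subgroupI[OF value_group_group])
  let ?H = "hom_cochains R M \<alpha> n"
  have D: "f xs \<in> carrier M" "\<alpha> (f xs) = f (map \<alpha> xs)" if "f \<in> ?H" "xs \<in> args M n" for f xs
    using that by (auto simp: hom_cochains_def PiE_iff)
  have E: "module_endo R M (\<lambda>y. f (xs[i := y]))" if "f \<in> ?H" "xs \<in> args M n" "i < n" for f xs i
    using that by (simp add: hom_cochains_def)
  have A: "f xs = \<zero>\<^bsub>M\<^esub>"
    if "f \<in> ?H" "xs \<in> args M n" "i < n" "j < n" "i \<noteq> j" "xs ! i = xs ! j" for f xs i j
    using that unfolding hom_cochains_def by blast
  show "?H \<subseteq> carrier (value_group M n)"
    by (auto simp: hom_cochains_def)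
  have I: "(\<lambda>xs\<in>args M n. F xs) \<in> ?H"
    if closed: "\<And>xs. xs \<in> args M n \<Longrightarrow> F xs \<in> carrier M"
      and lin: "\<And>xs i. \<lbrakk>xs \<in> args M n; i < n\<rbrakk> \<Longrightarrow> module_endo R M (\<lambda>y. F (xs[i := y]))"
      and alt: "\<And>xs i j. \<lbrakk>xs \<in> args M n; i < n; j < n; i \<noteq> j; xs ! i = xs ! j\<rbrakk> \<Longrightarrow> F xs = \<zero>\<^bsub>M\<^esub>"
      and tw: "\<And>xs. xs \<in> args M n \<Longrightarrow> \<alpha> (F xs) = F (map \<alpha> xs)" for F
  proof -
    have "module_endo R M (\<lambda>y. (\<lambda>xs\<in>args M n. F xs) (xs[i := y]))"
      if "xs \<in> args M n" "i < n" for xs i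
      by (rule module_endo_cong[OF _ lin[OF that]]) (simp add: args_update that)
    then show ?thesis
      unfolding hom_cochains_def using closed alt tw args_map[OF _ \<alpha>] by auto
  qed
  have "(\<lambda>xs\<in>args M n. \<zero>\<^bsub>M\<^esub>) \<in> ?H"
    by (rule I) (auto simp: module_endo_def module_endo_zero[OF \<alpha>])
  then show "?H \<noteq> {}" by blast
  fix f assume f: "f \<in> ?H"
  have "inv\<^bsub>value_group M n\<^esub> f = (\<lambda>xs\<in>args M n. \<ominus>\<^bsub>M\<^esub> f xs)"
    using f M.a_group by (subst inv_product_group) (auto simp: hom_cochains_def a_inv_def)
  moreover have "(\<lambda>xs\<in>args M n. \<ominus>\<^bsub>M\<^esub> f xs) \<in> ?H"
  proof (rule I)
    show "\<ominus>\<^bsub>M\<^esub> f xs = \<zero>\<^bsub>M\<^esub>"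
      if "xs \<in> args M n" "i < n" "j < n" "i \<noteq> j" "xs ! i = xs ! j" for xs i j
      using A[OF f that] by (simp add: M.minus_equality)
  qed (use D[OF f] E[OF f] in \<open>auto intro: module_endo_neg simp: module_endo_minus[OF \<alpha>]\<close>)
  ultimately show "inv\<^bsub>value_group M n\<^esub> f \<in> ?H" by simp
  fix g assume g: "g \<in> ?H"
  have "(\<lambda>xs\<in>args M n. f xs \<oplus>\<^bsub>M\<^esub> g xs) \<in> ?H"
  proof (rule I)
    show "f xs \<oplus>\<^bsub>M\<^esub> g xs = \<zero>\<^bsub>M\<^esub>"
      if "xs \<in> args M n" "i < n" "j < n" "i \<noteq> j" "xs ! i = xs ! j" for xs i j
      using A[OF f that] A[OF g that] by simp
  qed (use D[OF f] E[OF f] D[OF g] E[OF g] in \<open>auto intro: module_endo_add simp: module_endoD[OF \<alpha>]\<close>)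
  then show "f \<otimes>\<^bsub>value_group M n\<^esub> g \<in> ?H" by simp
qed

lemma hom_cochain_group_eq:
  "hom_cochain_group R M \<alpha> n = (value_group M n)\<lparr>carrier := hom_cochains R M \<alpha> n\<rparr>"
  by (simp add: hom_cochain_group_def product_group_def)

lemma chom_cochain_group_group:
  assumes "module_endo R M \<alpha>"
  shows "group (chom_cochain_group R M \<alpha> n)"
  unfolding chom_cochain_group_def hom_cochain_group_eq
  by (rule product_group)
    (rule subgroup.subgroup_is_group[OF hom_cochains_subgroup[OF assms] value_group_group])

end

locale bracket_cochains = module R M
  for R :: "('r, 'a) ring_scheme" (structure) and M :: "('r, 'v, 'b) module_scheme" (structure) +
  fixes \<alpha> :: "'v \<Rightarrow> 'v" and br\<^sub>1 br\<^sub>2 :: "'v \<Rightarrow> 'v \<Rightarrow> 'v"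
  assumes twist: "module_endo R M \<alpha>"
    and bracket_cochain1: "bracket_cochain M br\<^sub>1 \<in> hom_cochains R M \<alpha> 2"
    and bracket_cochain2: "bracket_cochain M br\<^sub>2 \<in> hom_cochains R M \<alpha> 2"
begin

lemma hom_delta_closed:
  assumes "bracket_cochain M br \<in> hom_cochains R M \<alpha> 2" "f \<in> hom_cochains R M \<alpha> 2" "xs \<in> args M 3"
  shows "hom_delta M br \<alpha> 2 f xs \<in> carrier M"
proof -
  obtain x y z where "x \<in> carrier M" "y \<in> carrier M" "z \<in> carrier M" "xs = [x, y, z]"
    using assms(3) args3 by blast
  then show ?thesis
    using assms by (simp add: hom_delta_eq_jacobiators[OF twist] jacobiator_closed twist cochain_op_bilinear)
qed

lemma hom_delta_add:
  assumes br: "bracket_cochain M br \<in> hom_cochains R M \<alpha> 2"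
    and f: "f \<in> hom_cochains R M \<alpha> 2" and g: "g \<in> hom_cochains R M \<alpha> 2" and xs: "xs \<in> args M 3"
  shows "hom_delta M br \<alpha> 2 (\<lambda>xs\<in>args M 2. f xs \<oplus>\<^bsub>M\<^esub> g xs) xs =
    hom_delta M br \<alpha> 2 f xs \<oplus>\<^bsub>M\<^esub> hom_delta M br \<alpha> 2 g xs"
proof -
  let ?h = "\<lambda>xs\<in>args M 2. f xs \<oplus>\<^bsub>M\<^esub> g xs"
  obtain x y z where xyz: "x \<in> carrier M" "y \<in> carrier M" "z \<in> carrier M" "xs = [x, y, z]"
    using xs args3 by blast
  have h: "?h \<in> hom_cochains R M \<alpha> 2"
    using subgroup.m_closed[OF hom_cochains_subgroup[OF twist] f g] by simp
  have op: "cochain_op ?h u v = cochain_op f u v \<oplus>\<^bsub>M\<^esub> cochain_op g u v"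
    if "u \<in> carrier M" "v \<in> carrier M" for u v
    using that by (simp add: cochain_op_def args2)
  note b = bilinear_op_simps(1-3)[OF cochain_op_bilinear[OF br]]
  note c = bilinear_op_simps(1)[OF cochain_op_bilinear[OF f]]
    bilinear_op_simps(1)[OF cochain_op_bilinear[OF g]]
  note a = module_endoD(1)[OF twist]
  show ?thesis
    unfolding xyz(4) hom_delta_eq_jacobiators[OF twist br f xyz(1-3)]
      hom_delta_eq_jacobiators[OF twist br g xyz(1-3)] hom_delta_eq_jacobiators[OF twist br h xyz(1-3)]
    using xyz(1-3) by (simp add: jacobiator_def op b c a M.minus_add M.a_ac)
qed

abbreviation "value_triples \<equiv> product_group {1..3::nat} (\<lambda>_. value_group M 3)"

lemma value_triples_group: "group value_triples"
  by (rule product_group) (rule value_group_group)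

lemma chom_delta_2:
  "chom_delta R M br\<^sub>1 br\<^sub>2 \<alpha> 2 \<nu> = (\<lambda>s\<in>{1..3}. \<lambda>xs\<in>args M 3.
     if s = 1 then hom_delta M br\<^sub>1 \<alpha> 2 (\<nu> 1) xs
     else if s = 2 then hom_delta M br\<^sub>1 \<alpha> 2 (\<nu> 2) xs \<oplus>\<^bsub>M\<^esub> hom_delta M br\<^sub>2 \<alpha> 2 (\<nu> 1) xs
     else hom_delta M br\<^sub>2 \<alpha> 2 (\<nu> 2) xs)"
proof
  fix s :: nat
  have ext: "hom_delta M br \<alpha> 2 f = (\<lambda>xs\<in>args M 3. hom_delta M br \<alpha> 2 f xs)" for br f
    by (auto simp: hom_delta_def fun_eq_iff)
  consider "s = 1" | "s = 2" | "s = 3" | "s \<notin> {1..3}" by fastforce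
  then show "chom_delta R M br\<^sub>1 br\<^sub>2 \<alpha> 2 \<nu> s = (\<lambda>s\<in>{1..3}. \<lambda>xs\<in>args M 3.
     if s = 1 then hom_delta M br\<^sub>1 \<alpha> 2 (\<nu> 1) xs
     else if s = 2 then hom_delta M br\<^sub>1 \<alpha> 2 (\<nu> 2) xs \<oplus>\<^bsub>M\<^esub> hom_delta M br\<^sub>2 \<alpha> 2 (\<nu> 1) xs
     else hom_delta M br\<^sub>2 \<alpha> 2 (\<nu> 2) xs) s"
  proof cases
    case 4
    then show ?thesis
      unfolding chom_delta_def by (simp only: restrict_apply Num.numeral_plus_one semiring_norm if_False)
  qed (use ext in \<open>simp_all add: chom_delta_def hom_cochain_group_def\<close>)
qed

lemma chom_delta_hom: "chom_delta R M br\<^sub>1 br\<^sub>2 \<alpha> 2 \<in> hom (chom_cochain_group R M \<alpha> 2) value_triples"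
proof (rule homI)
  let ?C = "chom_cochain_group R M \<alpha> 2"
  have mem: "f 1 \<in> hom_cochains R M \<alpha> 2" "f 2 \<in> hom_cochains R M \<alpha> 2" if "f \<in> carrier ?C" for f
    using that by (auto simp: chom_cochain_group_def hom_cochain_group_def PiE_iff)
  note closed = hom_delta_closed[OF bracket_cochain1] hom_delta_closed[OF bracket_cochain2]
  show "chom_delta R M br\<^sub>1 br\<^sub>2 \<alpha> 2 f \<in> carrier value_triples" if "f \<in> carrier ?C" for f
    unfolding chom_delta_2 using mem[OF that] by (auto intro!: closed)
  fix f g assume f: "f \<in> carrier ?C" and g: "g \<in> carrier ?C"
  have fg: "(f \<otimes>\<^bsub>?C\<^esub> g) s = (\<lambda>xs\<in>args M 2. f s xs \<oplus>\<^bsub>M\<^esub> g s xs)" if "s = 1 \<or> s = 2" for s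
    using that by (auto simp: chom_cochain_group_def hom_cochain_group_def)
  note add = hom_delta_add[OF bracket_cochain1] hom_delta_add[OF bracket_cochain2]
  have "chom_delta R M br\<^sub>1 br\<^sub>2 \<alpha> 2 (f \<otimes>\<^bsub>?C\<^esub> g) s xs =
      (chom_delta R M br\<^sub>1 br\<^sub>2 \<alpha> 2 f \<otimes>\<^bsub>value_triples\<^esub> chom_delta R M br\<^sub>1 br\<^sub>2 \<alpha> 2 g) s xs"
    if s: "s \<in> {1..3}" and xs: "xs \<in> args M 3" for s xs
  proof -
    consider "s = 1" | "s = 2" | "s = 3" using s by fastforce
    then show ?thesis
      by cases (use xs mem[OF f] mem[OF g] in \<open>simp_all add: chom_delta_2 fg add closed M.a_ac\<close>)
  qed
  then show "chom_delta R M br\<^sub>1 br\<^sub>2 \<alpha> 2 (f \<otimes>\<^bsub>?C\<^esub> g) =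
      chom_delta R M br\<^sub>1 br\<^sub>2 \<alpha> 2 f \<otimes>\<^bsub>value_triples\<^esub> chom_delta R M br\<^sub>1 br\<^sub>2 \<alpha> 2 g"
    by (auto simp: fun_eq_iff chom_delta_2)
qed

lemma coboundaries_subgroup: "subgroup (chom_coboundaries R M br\<^sub>1 br\<^sub>2 \<alpha> 3) value_triples"
proof -
  interpret group_hom "chom_cochain_group R M \<alpha> 2" value_triples "chom_delta R M br\<^sub>1 br\<^sub>2 \<alpha> 2"
    using chom_delta_hom chom_cochain_group_group[OF twist] value_triples_group
    by (simp add: group_hom_def group_hom_axioms_def)
  show ?thesis using img_is_subgroup by (simp add: chom_coboundaries_def)
qed

text \<open>Only the group operation and the representatives enter a coset of the coboundaries, so the
  coset in the group of cocycles can be computed in \<open>value_triples\<close>, where it is the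
  subgroup itself iff its representative is a coboundary.\<close>

lemma class_trivial_iff:
  assumes Ob: "Ob \<in> carrier value_triples"
  shows "chom_class R M br\<^sub>1 br\<^sub>2 \<alpha> 3 Ob = \<one>\<^bsub>chom_cohomology R M br\<^sub>1 br\<^sub>2 \<alpha> 3\<^esub> \<longleftrightarrow>
    Ob \<in> chom_coboundaries R M br\<^sub>1 br\<^sub>2 \<alpha> 3"
proof -
  let ?B = "chom_coboundaries R M br\<^sub>1 br\<^sub>2 \<alpha> 3"
  interpret T: group value_triples by (rule value_triples_group)
  have "chom_class R M br\<^sub>1 br\<^sub>2 \<alpha> 3 Ob = ?B #>\<^bsub>value_triples\<^esub> Ob"
    by (simp add: chom_class_def r_coset_def chom_cochain_group_def hom_cochain_group_def)
  moreover have "\<one>\<^bsub>chom_cohomology R M br\<^sub>1 br\<^sub>2 \<alpha> 3\<^esub> = ?B"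
    by (simp add: chom_cohomology_def FactGroup_def)
  ultimately show ?thesis
    using T.coset_join1[OF _ Ob coboundaries_subgroup] T.coset_join2[OF Ob coboundaries_subgroup]
    by auto
qed

end

section \<open>Extending a deformation by one order\<close>

context module
begin

lemma order_deformation_iff:
  assumes \<alpha>: "module_endo R M \<alpha>"
  shows "order_deformation R M br\<^sub>1 br\<^sub>2 \<alpha> p \<mu>\<^sub>1 \<mu>\<^sub>2 \<longleftrightarrow>
     \<mu>\<^sub>1 \<in> {..p} \<rightarrow>\<^sub>E hom_cochains R M \<alpha> 2 \<and> \<mu>\<^sub>2 \<in> {..p} \<rightarrow>\<^sub>E hom_cochains R M \<alpha> 2 \<and>
     \<mu>\<^sub>1 0 = bracket_cochain M br\<^sub>1 \<and> \<mu>\<^sub>2 0 = bracket_cochain M br\<^sub>2 \<and>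
     (\<forall>n\<le>p. \<forall>x\<in>carrier M. \<forall>y\<in>carrier M. \<forall>z\<in>carrier M.
      jacobi_coeff M \<alpha> \<mu>\<^sub>1 \<mu>\<^sub>1 n x y z = \<zero>\<^bsub>M\<^esub> \<and>
      jacobi_coeff M \<alpha> \<mu>\<^sub>1 \<mu>\<^sub>2 n x y z \<oplus>\<^bsub>M\<^esub> jacobi_coeff M \<alpha> \<mu>\<^sub>2 \<mu>\<^sub>1 n x y z = \<zero>\<^bsub>M\<^esub> \<and>
      jacobi_coeff M \<alpha> \<mu>\<^sub>2 \<mu>\<^sub>2 n x y z = \<zero>\<^bsub>M\<^esub>)"
proof (cases "\<mu>\<^sub>1 \<in> {..p} \<rightarrow>\<^sub>E hom_cochains R M \<alpha> 2 \<and> \<mu>\<^sub>2 \<in> {..p} \<rightarrow>\<^sub>E hom_cochains R M \<alpha> 2")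
  case True
  then interpret cochain_family_pair R M \<alpha> p \<mu>\<^sub>1 \<mu>\<^sub>2
    by unfold_locales (auto intro: \<alpha>)
  show ?thesis unfolding order_deformation_def compatible_trunc_iff by blast
next
  case False
  then show ?thesis unfolding order_deformation_def by blast
qed

end

text \<open>The part of the coefficient of \<open>t\<^sup>p\<^sup>+\<^sup>1\<close> in \<open>J(\<mu>\<^sub>t, \<nu>\<^sub>t)\<close> that involves neither the undeformed
  brackets nor any term of degree \<open>p + 1\<close>.\<close>

definition jacobi_cross ::
  "('r, 'v, 'b) module_scheme \<Rightarrow> ('v \<Rightarrow> 'v) \<Rightarrow> nat \<Rightarrow> (nat \<Rightarrow> 'v list \<Rightarrow> 'v) \<Rightarrow> (nat \<Rightarrow> 'v list \<Rightarrow> 'v) \<Rightarrow>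
   'v \<Rightarrow> 'v \<Rightarrow> 'v \<Rightarrow> 'v" where
  "jacobi_cross M \<alpha> p \<mu> \<nu> x y z =
     (\<Oplus>\<^bsub>M\<^esub>i\<in>{1..p}. jacobiator M \<alpha> (cochain_op (\<mu> i)) (cochain_op (\<nu> (p + 1 - i))) x y z)"

context cochain_family_pair
begin

lemma jac_closed:
  assumes "x \<in> carrier M" "y \<in> carrier M" "z \<in> carrier M"
    and "f \<in> hom_cochains R M \<alpha> 2" "g \<in> hom_cochains R M \<alpha> 2"
  shows "jacobiator M \<alpha> (cochain_op f) (cochain_op g) x y z \<in> carrier M"
  using assms by (intro first.jacobiator_closed first.cochain_op_bilinear first.twist)

lemma jacobi_cross_closed:
  assumes "x \<in> carrier M" "y \<in> carrier M" "z \<in> carrier M"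
  shows "jacobi_cross M \<alpha> p \<mu> \<nu> x y z \<in> carrier M"
  unfolding jacobi_cross_def using assms
  by (intro first.M.finsum_closed) (auto intro!: jac_closed first.cochain second.cochain)

text \<open>The two end terms of the sum are those that contain the new cochains.\<close>

lemma jacobi_coeff_update:
  assumes xyz: "x \<in> carrier M" "y \<in> carrier M" "z \<in> carrier M"
    and f: "f \<in> hom_cochains R M \<alpha> 2" and g: "g \<in> hom_cochains R M \<alpha> 2"
  shows "jacobi_coeff M \<alpha> (\<mu>(p + 1 := f)) (\<nu>(p + 1 := g)) (p + 1) x y z =
    jacobiator M \<alpha> (cochain_op (\<mu> 0)) (cochain_op g) x y z \<oplus>\<^bsub>M\<^esub>
    (jacobiator M \<alpha> (cochain_op f) (cochain_op (\<nu> 0)) x y z \<oplus>\<^bsub>M\<^esub>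
     jacobi_cross M \<alpha> p \<mu> \<nu> x y z)"
proof -
  define F where "F i = jacobiator M \<alpha> (cochain_op ((\<mu>(p + 1 := f)) i))
    (cochain_op ((\<nu>(p + 1 := g)) (p + 1 - i))) x y z" for i
  have F0: "F 0 = jacobiator M \<alpha> (cochain_op (\<mu> 0)) (cochain_op g) x y z"
    and F1: "F (p + 1) = jacobiator M \<alpha> (cochain_op f) (cochain_op (\<nu> 0)) x y z"
    by (simp_all add: F_def)
  have Fi: "F i = jacobiator M \<alpha> (cochain_op (\<mu> i)) (cochain_op (\<nu> (p + 1 - i))) x y z"
    if "i \<in> {1..p}" for i
    using that by (auto simp: F_def)
  have F_closed: "F i \<in> carrier M" if "i \<le> p + 1" for i
    unfolding F_def using f g that
    by (intro jac_closed xyz) (auto intro: first.cochain second.cochain)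
  have "{..p + 1} = insert 0 (insert (p + 1) {1..p})" by auto
  then have "(\<Oplus>\<^bsub>M\<^esub>i\<in>{..p + 1}. F i) = F 0 \<oplus>\<^bsub>M\<^esub> (F (p + 1) \<oplus>\<^bsub>M\<^esub> (\<Oplus>\<^bsub>M\<^esub>i\<in>{1..p}. F i))"
    using F_closed by (simp add: Pi_def)
  moreover have "(\<Oplus>\<^bsub>M\<^esub>i\<in>{1..p}. F i) = jacobi_cross M \<alpha> p \<mu> \<nu> x y z"
    unfolding jacobi_cross_def
  proof (rule first.M.add.finprod_cong'[OF refl _ Fi])
    show "(\<lambda>i. jacobiator M \<alpha> (cochain_op (\<mu> i)) (cochain_op (\<nu> (p + 1 - i))) x y z) \<in> {1..p} \<rightarrow> carrier M"
      by (auto intro!: jac_closed xyz first.cochain second.cochain)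
  qed
  ultimately show ?thesis
    unfolding jacobi_coeff_def F_def[symmetric] F0 F1 by simp
qed

lemma jacobi_coeff_update_below:
  assumes "n \<le> p" "x \<in> carrier M" "y \<in> carrier M" "z \<in> carrier M"
  shows "jacobi_coeff M \<alpha> (\<mu>(p + 1 := f)) (\<nu>(p + 1 := g)) n x y z = jacobi_coeff M \<alpha> \<mu> \<nu> n x y z"
  unfolding jacobi_coeff_def using assms
  by (intro first.M.add.finprod_cong') (auto intro!: jac_closed first.cochain second.cochain)

text \<open>Reversing the summation by \<open>i \<mapsto> p + 1 - i\<close> identifies the second half of the brackets with the
  cross terms of the exchanged pair.\<close>

lemma sum_nr_bracket:
  assumes xyz: "x \<in> carrier M" "y \<in> carrier M" "z \<in> carrier M"
  shows "(\<Oplus>\<^bsub>M\<^esub>i\<in>{1..p}. nr_bracket M \<alpha> 1 1 (\<mu> i) (\<nu> (p + 1 - i)) [x, y, z]) =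
    jacobi_cross M \<alpha> p \<mu> \<nu> x y z \<oplus>\<^bsub>M\<^esub> jacobi_cross M \<alpha> p \<nu> \<mu> x y z"
proof -
  have "jacobi_cross M \<alpha> p \<nu> \<mu> x y z =
    (\<Oplus>\<^bsub>M\<^esub>i\<in>{1..p}. jacobiator M \<alpha> (cochain_op (\<nu> (p + 1 - i))) (cochain_op (\<mu> i)) x y z)"
    unfolding jacobi_cross_def
    by (rule first.M.finsum_bij[where h = "\<lambda>i. p + 1 - i"])
      (auto intro!: bij_betw_byWitness[where f' = "\<lambda>i. p + 1 - i"] jac_closed xyz
        first.cochain second.cochain)
  moreover have "(\<Oplus>\<^bsub>M\<^esub>i\<in>{1..p}. nr_bracket M \<alpha> 1 1 (\<mu> i) (\<nu> (p + 1 - i)) [x, y, z]) =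
    (\<Oplus>\<^bsub>M\<^esub>i\<in>{1..p}. jacobiator M \<alpha> (cochain_op (\<mu> i)) (cochain_op (\<nu> (p + 1 - i))) x y z) \<oplus>\<^bsub>M\<^esub>
    (\<Oplus>\<^bsub>M\<^esub>i\<in>{1..p}. jacobiator M \<alpha> (cochain_op (\<nu> (p + 1 - i))) (cochain_op (\<mu> i)) x y z)"
  proof (rule first.M.finsum_split_add)
    fix i assume "i \<in> {1..p}"
    then have "\<mu> i \<in> hom_cochains R M \<alpha> 2" "\<nu> (p + 1 - i) \<in> hom_cochains R M \<alpha> 2"
      by (auto intro: first.cochain second.cochain)
    then show "nr_bracket M \<alpha> 1 1 (\<mu> i) (\<nu> (p + 1 - i)) [x, y, z] =
      jacobiator M \<alpha> (cochain_op (\<mu> i)) (cochain_op (\<nu> (p + 1 - i))) x y z \<oplus>\<^bsub>M\<^esub>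
      jacobiator M \<alpha> (cochain_op (\<nu> (p + 1 - i))) (cochain_op (\<mu> i)) x y z"
      by (rule first.nr_bracket_eq_jacobiators[OF first.twist _ _ xyz])
  qed (auto intro!: jac_closed xyz first.cochain second.cochain)
  ultimately show ?thesis
    by (simp only: jacobi_cross_def[of _ _ _ \<mu>])
qed

end

lemma (in abelian_group) sum_zero_iff:
  assumes "a \<in> carrier G" "b \<in> carrier G"
  shows "a \<oplus> b = \<zero> \<longleftrightarrow> b = \<ominus> a"
  using assms by (metis a_comm minus_equality minus_minus r_neg)

context bracket_cochains
begin

text \<open>When both arguments are the same family, the two cross terms in \<open>sum_nr_bracket\<close> coincide,
  and the factor one half removes the duplication. This is where the invertibility of \<open>2\<close> enters.\<close>

lemma obstruction_apply:
  assumes \<mu>\<^sub>1: "\<mu>\<^sub>1 \<in> {..p} \<rightarrow>\<^sub>E hom_cochains R M \<alpha> 2"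
    and \<mu>\<^sub>2: "\<mu>\<^sub>2 \<in> {..p} \<rightarrow>\<^sub>E hom_cochains R M \<alpha> 2"
    and two: "\<one> \<oplus> \<one> \<in> Units R"
    and xyz: "x \<in> carrier M" "y \<in> carrier M" "z \<in> carrier M"
  shows "obstruction R M \<alpha> p \<mu>\<^sub>1 \<mu>\<^sub>2 1 [x, y, z] = jacobi_cross M \<alpha> p \<mu>\<^sub>1 \<mu>\<^sub>1 x y z"
    and "obstruction R M \<alpha> p \<mu>\<^sub>1 \<mu>\<^sub>2 2 [x, y, z] =
      jacobi_cross M \<alpha> p \<mu>\<^sub>1 \<mu>\<^sub>2 x y z \<oplus>\<^bsub>M\<^esub> jacobi_cross M \<alpha> p \<mu>\<^sub>2 \<mu>\<^sub>1 x y z"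
    and "obstruction R M \<alpha> p \<mu>\<^sub>1 \<mu>\<^sub>2 3 [x, y, z] = jacobi_cross M \<alpha> p \<mu>\<^sub>2 \<mu>\<^sub>2 x y z"
proof -
  interpret P: cochain_family_pair R M \<alpha> p \<mu>\<^sub>1 \<mu>\<^sub>2
    using \<mu>\<^sub>1 \<mu>\<^sub>2 by unfold_locales (auto intro: twist)
  interpret P1: cochain_family_pair R M \<alpha> p \<mu>\<^sub>1 \<mu>\<^sub>1 ..
  interpret P2: cochain_family_pair R M \<alpha> p \<mu>\<^sub>2 \<mu>\<^sub>2 ..
  have half: "inv (\<one> \<oplus> \<one>) \<odot>\<^bsub>M\<^esub> (v \<oplus>\<^bsub>M\<^esub> v) = v" if v: "v \<in> carrier M" for v
  proof -
    have "v \<oplus>\<^bsub>M\<^esub> v = (\<one> \<oplus> \<one>) \<odot>\<^bsub>M\<^esub> v" using v by (simp add: smult_l_distr)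
    also have "inv (\<one> \<oplus> \<one>) \<odot>\<^bsub>M\<^esub> \<dots> = (inv (\<one> \<oplus> \<one>) \<otimes> (\<one> \<oplus> \<one>)) \<odot>\<^bsub>M\<^esub> v"
      using v two by (intro smult_assoc1[symmetric]) auto
    also have "\<dots> = v" using v two by simp
    finally show ?thesis .
  qed
  have xs: "[x, y, z] \<in> args M 3" using xyz by (auto simp: args3)
  show "obstruction R M \<alpha> p \<mu>\<^sub>1 \<mu>\<^sub>2 1 [x, y, z] = jacobi_cross M \<alpha> p \<mu>\<^sub>1 \<mu>\<^sub>1 x y z"
    using xs P1.sum_nr_bracket[OF xyz] half[OF P1.jacobi_cross_closed[OF xyz]]
    by (simp add: obstruction_def Let_def)
  show "obstruction R M \<alpha> p \<mu>\<^sub>1 \<mu>\<^sub>2 3 [x, y, z] = jacobi_cross M \<alpha> p \<mu>\<^sub>2 \<mu>\<^sub>2 x y z"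
    using xs P2.sum_nr_bracket[OF xyz] half[OF P2.jacobi_cross_closed[OF xyz]]
    by (simp add: obstruction_def Let_def)
  show "obstruction R M \<alpha> p \<mu>\<^sub>1 \<mu>\<^sub>2 2 [x, y, z] =
      jacobi_cross M \<alpha> p \<mu>\<^sub>1 \<mu>\<^sub>2 x y z \<oplus>\<^bsub>M\<^esub> jacobi_cross M \<alpha> p \<mu>\<^sub>2 \<mu>\<^sub>1 x y z"
    using xs P.sum_nr_bracket[OF xyz] by (simp add: obstruction_def Let_def)
qed

lemma value_triples_eqI:
  assumes "f \<in> carrier value_triples" "g \<in> carrier value_triples"
    and "\<And>s x y z. \<lbrakk>s \<in> {1..3}; x \<in> carrier M; y \<in> carrier M; z \<in> carrier M\<rbrakk> \<Longrightarrow>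
      f s [x, y, z] = g s [x, y, z]"
  shows "f = g"
proof (rule extensionalityI)
  show "f \<in> extensional {1..3}" "g \<in> extensional {1..3}"
    using assms(1,2) by (auto simp: PiE_iff)
  fix s :: nat assume s: "s \<in> {1..3}"
  show "f s = g s"
  proof (rule extensionalityI)
    show "f s \<in> extensional (args M 3)" "g s \<in> extensional (args M 3)"
      using assms(1,2) s by (auto simp: PiE_iff)
    show "f s xs = g s xs" if "xs \<in> args M 3" for xs
      using that s assms(3) unfolding args3 by blast
  qed
qed

lemma obstruction_closed:
  assumes \<mu>\<^sub>1: "\<mu>\<^sub>1 \<in> {..p} \<rightarrow>\<^sub>E hom_cochains R M \<alpha> 2"
    and \<mu>\<^sub>2: "\<mu>\<^sub>2 \<in> {..p} \<rightarrow>\<^sub>E hom_cochains R M \<alpha> 2"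
    and two: "\<one> \<oplus> \<one> \<in> Units R"
  shows "obstruction R M \<alpha> p \<mu>\<^sub>1 \<mu>\<^sub>2 \<in> carrier value_triples"
proof -
  interpret P: cochain_family_pair R M \<alpha> p \<mu>\<^sub>1 \<mu>\<^sub>2
    using \<mu>\<^sub>1 \<mu>\<^sub>2 by unfold_locales (auto intro: twist)
  interpret P': cochain_family_pair R M \<alpha> p \<mu>\<^sub>2 \<mu>\<^sub>1 ..
  interpret P1: cochain_family_pair R M \<alpha> p \<mu>\<^sub>1 \<mu>\<^sub>1 ..
  interpret P2: cochain_family_pair R M \<alpha> p \<mu>\<^sub>2 \<mu>\<^sub>2 ..
  have "obstruction R M \<alpha> p \<mu>\<^sub>1 \<mu>\<^sub>2 s [x, y, z] \<in> carrier M"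
    if "s \<in> {1..3}" and xyz: "x \<in> carrier M" "y \<in> carrier M" "z \<in> carrier M" for s x y z
  proof -
    consider "s = 1" | "s = 2" | "s = 3" using \<open>s \<in> {1..3}\<close> by fastforce
    then show ?thesis
      by cases (simp_all only: obstruction_apply[OF \<mu>\<^sub>1 \<mu>\<^sub>2 two xyz] M.a_closed P.jacobi_cross_closed[OF xyz]
          P'.jacobi_cross_closed[OF xyz] P1.jacobi_cross_closed[OF xyz] P2.jacobi_cross_closed[OF xyz])
  qed
  then have "obstruction R M \<alpha> p \<mu>\<^sub>1 \<mu>\<^sub>2 s xs \<in> carrier M" if "s \<in> {1..3}" "xs \<in> args M 3" for s xs
    using that unfolding args3 by blast
  moreover have "obstruction R M \<alpha> p \<mu>\<^sub>1 \<mu>\<^sub>2 \<in> extensional {1..3}"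
    and "\<And>s. s \<in> {1..3} \<Longrightarrow> obstruction R M \<alpha> p \<mu>\<^sub>1 \<mu>\<^sub>2 s \<in> extensional (args M 3)"
    by (simp_all add: obstruction_def Let_def)
  ultimately show ?thesis
    by (simp only: carrier_product_group PiE_iff partial_object.simps) simp
qed

text \<open>In degree \<open>p + 1\<close> each of the three Jacobi equations reads \<open>A + q = 0\<close>, where \<open>A\<close> collects
  the terms with the new cochains and \<open>q\<close> is an entry of the obstruction cochain. The corresponding entry of
  the total coboundary of \<open>\<nu>\<close> is \<open>- A\<close>.\<close>

lemma obstruction_eq_delta_iff:
  assumes \<mu>\<^sub>1: "\<mu>\<^sub>1 \<in> {..p} \<rightarrow>\<^sub>E hom_cochains R M \<alpha> 2"
    and \<mu>\<^sub>2: "\<mu>\<^sub>2 \<in> {..p} \<rightarrow>\<^sub>E hom_cochains R M \<alpha> 2"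
    and two: "\<one> \<oplus> \<one> \<in> Units R"
    and init: "\<mu>\<^sub>1 0 = bracket_cochain M br\<^sub>1" "\<mu>\<^sub>2 0 = bracket_cochain M br\<^sub>2"
    and \<nu>: "\<nu> \<in> carrier (chom_cochain_group R M \<alpha> 2)"
  shows "obstruction R M \<alpha> p \<mu>\<^sub>1 \<mu>\<^sub>2 = chom_delta R M br\<^sub>1 br\<^sub>2 \<alpha> 2 \<nu> \<longleftrightarrow>
    (\<forall>x\<in>carrier M. \<forall>y\<in>carrier M. \<forall>z\<in>carrier M.
      jacobi_coeff M \<alpha> (\<mu>\<^sub>1(p + 1 := \<nu> 1)) (\<mu>\<^sub>1(p + 1 := \<nu> 1)) (p + 1) x y z = \<zero>\<^bsub>M\<^esub> \<and>
      jacobi_coeff M \<alpha> (\<mu>\<^sub>1(p + 1 := \<nu> 1)) (\<mu>\<^sub>2(p + 1 := \<nu> 2)) (p + 1) x y z \<oplus>\<^bsub>M\<^esub>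
        jacobi_coeff M \<alpha> (\<mu>\<^sub>2(p + 1 := \<nu> 2)) (\<mu>\<^sub>1(p + 1 := \<nu> 1)) (p + 1) x y z = \<zero>\<^bsub>M\<^esub> \<and>
      jacobi_coeff M \<alpha> (\<mu>\<^sub>2(p + 1 := \<nu> 2)) (\<mu>\<^sub>2(p + 1 := \<nu> 2)) (p + 1) x y z = \<zero>\<^bsub>M\<^esub>)"
    (is "?Ob = ?D \<longleftrightarrow>
      (\<forall>x\<in>_. \<forall>y\<in>_. \<forall>z\<in>_. ?c11 x y z = _ \<and> ?c12 x y z \<oplus>\<^bsub>M\<^esub> ?c21 x y z = _ \<and> ?c22 x y z = _)")
proof -
  interpret P: cochain_family_pair R M \<alpha> p \<mu>\<^sub>1 \<mu>\<^sub>2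
    using \<mu>\<^sub>1 \<mu>\<^sub>2 by unfold_locales (auto intro: twist)
  interpret P': cochain_family_pair R M \<alpha> p \<mu>\<^sub>2 \<mu>\<^sub>1 ..
  interpret P1: cochain_family_pair R M \<alpha> p \<mu>\<^sub>1 \<mu>\<^sub>1 ..
  interpret P2: cochain_family_pair R M \<alpha> p \<mu>\<^sub>2 \<mu>\<^sub>2 ..
  have mem: "\<nu> 1 \<in> hom_cochains R M \<alpha> 2" "\<nu> 2 \<in> hom_cochains R M \<alpha> 2"
    using \<nu> by (auto simp: chom_cochain_group_def hom_cochain_group_def PiE_iff)
  have pointwise: "(?Ob 1 [x, y, z] = ?D 1 [x, y, z] \<longleftrightarrow> ?c11 x y z = \<zero>\<^bsub>M\<^esub>) \<and>
      (?Ob 2 [x, y, z] = ?D 2 [x, y, z] \<longleftrightarrow> ?c12 x y z \<oplus>\<^bsub>M\<^esub> ?c21 x y z = \<zero>\<^bsub>M\<^esub>) \<and>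
      (?Ob 3 [x, y, z] = ?D 3 [x, y, z] \<longleftrightarrow> ?c22 x y z = \<zero>\<^bsub>M\<^esub>)"
    if xyz: "x \<in> carrier M" "y \<in> carrier M" "z \<in> carrier M" for x y z
  proof -
    have xs: "[x, y, z] \<in> args M 3" using xyz by (auto simp: args3)
    let ?j = "\<lambda>f g. jacobiator M \<alpha> (cochain_op f) (cochain_op g) x y z"
    let ?b1 = "bracket_cochain M br\<^sub>1" and ?b2 = "bracket_cochain M br\<^sub>2"
    note j = P.jac_closed[OF xyz] bracket_cochain1 bracket_cochain2 mem
    note q = P.jacobi_cross_closed[OF xyz] P'.jacobi_cross_closed[OF xyz]
      P1.jacobi_cross_closed[OF xyz] P2.jacobi_cross_closed[OF xyz]
    note coeff = P.jacobi_coeff_update[OF xyz mem(1,2)] P'.jacobi_coeff_update[OF xyz mem(2,1)]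
      P1.jacobi_coeff_update[OF xyz mem(1,1)] P2.jacobi_coeff_update[OF xyz mem(2,2)]
    have D: "?D 1 [x, y, z] = \<ominus>\<^bsub>M\<^esub> (?j ?b1 (\<nu> 1) \<oplus>\<^bsub>M\<^esub> ?j (\<nu> 1) ?b1)"
      "?D 2 [x, y, z] = \<ominus>\<^bsub>M\<^esub> (?j ?b1 (\<nu> 2) \<oplus>\<^bsub>M\<^esub> ?j (\<nu> 2) ?b1) \<oplus>\<^bsub>M\<^esub>
         \<ominus>\<^bsub>M\<^esub> (?j ?b2 (\<nu> 1) \<oplus>\<^bsub>M\<^esub> ?j (\<nu> 1) ?b2)"
      "?D 3 [x, y, z] = \<ominus>\<^bsub>M\<^esub> (?j ?b2 (\<nu> 2) \<oplus>\<^bsub>M\<^esub> ?j (\<nu> 2) ?b2)"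
      using xs by (simp_all add: chom_delta_2
          hom_delta_eq_jacobiators[OF twist bracket_cochain1 mem(1) xyz, simplified]
          hom_delta_eq_jacobiators[OF twist bracket_cochain1 mem(2) xyz]
          hom_delta_eq_jacobiators[OF twist bracket_cochain2 mem(1) xyz, simplified]
          hom_delta_eq_jacobiators[OF twist bracket_cochain2 mem(2) xyz])
    have "?c11 x y z = (?j ?b1 (\<nu> 1) \<oplus>\<^bsub>M\<^esub> ?j (\<nu> 1) ?b1) \<oplus>\<^bsub>M\<^esub> jacobi_cross M \<alpha> p \<mu>\<^sub>1 \<mu>\<^sub>1 x y z"
      unfolding coeff init using j q by (simp add: M.a_assoc)
    moreover have "?c22 x y z = (?j ?b2 (\<nu> 2) \<oplus>\<^bsub>M\<^esub> ?j (\<nu> 2) ?b2) \<oplus>\<^bsub>M\<^esub> jacobi_cross M \<alpha> p \<mu>\<^sub>2 \<mu>\<^sub>2 x y z"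
      unfolding coeff init using j q by (simp add: M.a_assoc)
    moreover have "?c12 x y z \<oplus>\<^bsub>M\<^esub> ?c21 x y z =
      ((?j ?b1 (\<nu> 2) \<oplus>\<^bsub>M\<^esub> ?j (\<nu> 2) ?b1) \<oplus>\<^bsub>M\<^esub> (?j ?b2 (\<nu> 1) \<oplus>\<^bsub>M\<^esub> ?j (\<nu> 1) ?b2)) \<oplus>\<^bsub>M\<^esub>
       (jacobi_cross M \<alpha> p \<mu>\<^sub>1 \<mu>\<^sub>2 x y z \<oplus>\<^bsub>M\<^esub> jacobi_cross M \<alpha> p \<mu>\<^sub>2 \<mu>\<^sub>1 x y z)"
      unfolding coeff init using j q by (simp add: M.a_ac)
    ultimately show ?thesis
      unfolding obstruction_apply[OF \<mu>\<^sub>1 \<mu>\<^sub>2 two xyz] D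
      using j q by (simp add: M.sum_zero_iff M.minus_add)
  qed
  have D: "?D \<in> carrier value_triples"
    using chom_delta_hom \<nu> by (auto simp: hom_def)
  show ?thesis
  proof
    assume "?Ob = ?D"
    then show "\<forall>x\<in>carrier M. \<forall>y\<in>carrier M. \<forall>z\<in>carrier M.
        ?c11 x y z = \<zero>\<^bsub>M\<^esub> \<and> ?c12 x y z \<oplus>\<^bsub>M\<^esub> ?c21 x y z = \<zero>\<^bsub>M\<^esub> \<and> ?c22 x y z = \<zero>\<^bsub>M\<^esub>"
      using pointwise by metis
  next
    assume *: "\<forall>x\<in>carrier M. \<forall>y\<in>carrier M. \<forall>z\<in>carrier M.
        ?c11 x y z = \<zero>\<^bsub>M\<^esub> \<and> ?c12 x y z \<oplus>\<^bsub>M\<^esub> ?c21 x y z = \<zero>\<^bsub>M\<^esub> \<and> ?c22 x y z = \<zero>\<^bsub>M\<^esub>"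
    show "?Ob = ?D"
    proof (rule value_triples_eqI[OF obstruction_closed[OF \<mu>\<^sub>1 \<mu>\<^sub>2 two] D])
      fix s :: nat and x y z assume s: "s \<in> {1..3}"
        and xyz: "x \<in> carrier M" "y \<in> carrier M" "z \<in> carrier M"
      consider "s = 1" | "s = 2" | "s = 3" using s by fastforce
      then show "?Ob s [x, y, z] = ?D s [x, y, z]"
        using pointwise[OF xyz] * xyz by cases blast+
    qed
  qed
qed

text \<open>The equations of degree at most \<open>p\<close> hold by assumption and do not see the new cochains, so only
  those of degree \<open>p + 1\<close> are at stake.\<close>

lemma order_deformation_Suc_iff:
  assumes def: "order_deformation R M br\<^sub>1 br\<^sub>2 \<alpha> p \<mu>\<^sub>1 \<mu>\<^sub>2"
    and two: "\<one> \<oplus> \<one> \<in> Units R" and \<nu>: "\<nu> \<in> carrier (chom_cochain_group R M \<alpha> 2)"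
  shows "order_deformation R M br\<^sub>1 br\<^sub>2 \<alpha> (p + 1) (\<mu>\<^sub>1(p + 1 := \<nu> 1)) (\<mu>\<^sub>2(p + 1 := \<nu> 2)) \<longleftrightarrow>
    obstruction R M \<alpha> p \<mu>\<^sub>1 \<mu>\<^sub>2 = chom_delta R M br\<^sub>1 br\<^sub>2 \<alpha> 2 \<nu>"
proof -
  note d = def[unfolded order_deformation_iff[OF twist]]
  have \<mu>: "\<mu>\<^sub>1 \<in> {..p} \<rightarrow>\<^sub>E hom_cochains R M \<alpha> 2" "\<mu>\<^sub>2 \<in> {..p} \<rightarrow>\<^sub>E hom_cochains R M \<alpha> 2"
    and init: "\<mu>\<^sub>1 0 = bracket_cochain M br\<^sub>1" "\<mu>\<^sub>2 0 = bracket_cochain M br\<^sub>2"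
    using d by auto
  have mem: "\<nu> 1 \<in> hom_cochains R M \<alpha> 2" "\<nu> 2 \<in> hom_cochains R M \<alpha> 2"
    using \<nu> by (auto simp: chom_cochain_group_def hom_cochain_group_def PiE_iff)
  have ext: "\<mu>\<^sub>1(p + 1 := \<nu> 1) \<in> {..p + 1} \<rightarrow>\<^sub>E hom_cochains R M \<alpha> 2"
    "\<mu>\<^sub>2(p + 1 := \<nu> 2) \<in> {..p + 1} \<rightarrow>\<^sub>E hom_cochains R M \<alpha> 2"
    using \<mu> mem by (auto simp: PiE_iff extensional_def le_Suc_eq)
  interpret P: cochain_family_pair R M \<alpha> p \<mu>\<^sub>1 \<mu>\<^sub>2
    using \<mu> by unfold_locales (auto intro: twist)
  interpret P': cochain_family_pair R M \<alpha> p \<mu>\<^sub>2 \<mu>\<^sub>1 ..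
  interpret P1: cochain_family_pair R M \<alpha> p \<mu>\<^sub>1 \<mu>\<^sub>1 ..
  interpret P2: cochain_family_pair R M \<alpha> p \<mu>\<^sub>2 \<mu>\<^sub>2 ..
  note low = P.jacobi_coeff_update_below P'.jacobi_coeff_update_below
    P1.jacobi_coeff_update_below P2.jacobi_coeff_update_below
  have split: "(\<forall>n\<le>p + 1. Q n) \<longleftrightarrow> (\<forall>n\<le>p. Q n) \<and> Q (p + 1)" for Q :: "nat \<Rightarrow> bool"
    by (auto simp: le_Suc_eq)
  have below: "\<forall>n\<le>p. \<forall>x\<in>carrier M. \<forall>y\<in>carrier M. \<forall>z\<in>carrier M.
      jacobi_coeff M \<alpha> (\<mu>\<^sub>1(p + 1 := \<nu> 1)) (\<mu>\<^sub>1(p + 1 := \<nu> 1)) n x y z = \<zero>\<^bsub>M\<^esub> \<and>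
      jacobi_coeff M \<alpha> (\<mu>\<^sub>1(p + 1 := \<nu> 1)) (\<mu>\<^sub>2(p + 1 := \<nu> 2)) n x y z \<oplus>\<^bsub>M\<^esub>
        jacobi_coeff M \<alpha> (\<mu>\<^sub>2(p + 1 := \<nu> 2)) (\<mu>\<^sub>1(p + 1 := \<nu> 1)) n x y z = \<zero>\<^bsub>M\<^esub> \<and>
      jacobi_coeff M \<alpha> (\<mu>\<^sub>2(p + 1 := \<nu> 2)) (\<mu>\<^sub>2(p + 1 := \<nu> 2)) n x y z = \<zero>\<^bsub>M\<^esub>"
  proof (intro allI impI ballI)
    fix n x y z assume n: "n \<le> p" and xyz: "x \<in> carrier M" "y \<in> carrier M" "z \<in> carrier M"
    show "jacobi_coeff M \<alpha> (\<mu>\<^sub>1(p + 1 := \<nu> 1)) (\<mu>\<^sub>1(p + 1 := \<nu> 1)) n x y z = \<zero>\<^bsub>M\<^esub> \<and>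
      jacobi_coeff M \<alpha> (\<mu>\<^sub>1(p + 1 := \<nu> 1)) (\<mu>\<^sub>2(p + 1 := \<nu> 2)) n x y z \<oplus>\<^bsub>M\<^esub>
        jacobi_coeff M \<alpha> (\<mu>\<^sub>2(p + 1 := \<nu> 2)) (\<mu>\<^sub>1(p + 1 := \<nu> 1)) n x y z = \<zero>\<^bsub>M\<^esub> \<and>
      jacobi_coeff M \<alpha> (\<mu>\<^sub>2(p + 1 := \<nu> 2)) (\<mu>\<^sub>2(p + 1 := \<nu> 2)) n x y z = \<zero>\<^bsub>M\<^esub>"
      unfolding low[OF n xyz] using d n xyz by blast
  qed
  have "(\<mu>\<^sub>1(p + 1 := \<nu> 1)) 0 = bracket_cochain M br\<^sub>1" "(\<mu>\<^sub>2(p + 1 := \<nu> 2)) 0 = bracket_cochain M br\<^sub>2"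
    using init by simp_all
  with ext below show ?thesis
    unfolding order_deformation_iff[OF twist] obstruction_eq_delta_iff[OF \<mu> two init \<nu>] split
    by blast
qed

end

theorem theorem5p11:
  fixes K :: "('k, 'a) ring_scheme"
    and G :: "('k, 'v, 'b) module_scheme"
    and br\<^sub>1 br\<^sub>2 :: "'v \<Rightarrow> 'v \<Rightarrow> 'v"
    and \<alpha> :: "'v \<Rightarrow> 'v"
    and p :: nat
    and \<mu>\<^sub>1 \<mu>\<^sub>2 :: "nat \<Rightarrow> 'v list \<Rightarrow> 'v"
  assumes "field K" and "char_zero K"
    and "compatible_hom_lie_algebra K G br\<^sub>1 br\<^sub>2 \<alpha>"
    and "order_deformation K G br\<^sub>1 br\<^sub>2 \<alpha> p \<mu>\<^sub>1 \<mu>\<^sub>2"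
  shows "extensible K G br\<^sub>1 br\<^sub>2 \<alpha> p \<mu>\<^sub>1 \<mu>\<^sub>2 \<longleftrightarrow>
    chom_class K G br\<^sub>1 br\<^sub>2 \<alpha> 3 (obstruction K G \<alpha> p \<mu>\<^sub>1 \<mu>\<^sub>2) =
      \<one>\<^bsub>chom_cohomology K G br\<^sub>1 br\<^sub>2 \<alpha> 3\<^esub>"
proof -
  interpret F: field K by fact
  interpret L: compatible_hom_lie_algebra K G br\<^sub>1 br\<^sub>2 \<alpha> by fact
  have \<mu>: "\<mu>\<^sub>1 \<in> {..p} \<rightarrow>\<^sub>E hom_cochains K G \<alpha> 2" "\<mu>\<^sub>2 \<in> {..p} \<rightarrow>\<^sub>E hom_cochains K G \<alpha> 2"
    and init: "\<mu>\<^sub>1 0 = bracket_cochain G br\<^sub>1" "\<mu>\<^sub>2 0 = bracket_cochain G br\<^sub>2"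
    using assms(4) by (auto simp: order_deformation_def)
  interpret B: bracket_cochains K G \<alpha> br\<^sub>1 br\<^sub>2
  proof
    show "module_endo K G \<alpha>" by (rule L.first.twist_linear)
    show "bracket_cochain G br\<^sub>1 \<in> hom_cochains K G \<alpha> 2" "bracket_cochain G br\<^sub>2 \<in> hom_cochains K G \<alpha> 2"
      using \<mu> unfolding init[symmetric] by auto
  qed
  have "[(2::nat)] \<cdot>\<^bsub>K\<^esub> \<one>\<^bsub>K\<^esub> \<noteq> \<zero>\<^bsub>K\<^esub>"
    using assms(2) by (simp add: char_zero_def)
  then have two: "\<one>\<^bsub>K\<^esub> \<oplus>\<^bsub>K\<^esub> \<one>\<^bsub>K\<^esub> \<in> Units K"
    by (simp add: F.field_Units numeral_2_eq_2)
  have "extensible K G br\<^sub>1 br\<^sub>2 \<alpha> p \<mu>\<^sub>1 \<mu>\<^sub>2 \<longleftrightarrow>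
      obstruction K G \<alpha> p \<mu>\<^sub>1 \<mu>\<^sub>2 \<in> chom_coboundaries K G br\<^sub>1 br\<^sub>2 \<alpha> 3"
    unfolding extensible_def chom_coboundaries_def
    using B.order_deformation_Suc_iff[OF assms(4) two] by auto
  then show ?thesis
    using B.class_trivial_iff[OF B.obstruction_closed[OF \<mu> two]] by simp
qed

end
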